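(* Let $(\widetilde V_n)_{n\ge 0}$ and $(\widetilde u_n)_{n\ge 0}$ be any sequences of reduced spaces and reduced solutions generated by the residual based online enrichment algorithm (described in the context), and let $u\in V$ be the exact solution. Then for every $n \ge 0$ $$\|u-\widetilde u_{n+1}\|_a \le c\,\|u-\widetilde u_n\|_a, \qquad c := \sqrt{1-\frac{1}{N_D}\,\frac{1}{c_{pu}^2}},$$ where $N_D$ is the number of subdomains and $c_{pu}$ is the partition of unity stability constant defined in the context.
   Context: Setting. Let $\Omega\subset\mathbb R^d$, $d\in\{2,3\}$, be a bounded domain, $\kappa:\Omega\to\mathbb R$ a measurable heat conductivity with $0<\kappa_{min}\le\kappa\le\kappa_{max}<\infty$ a.e., and $f\in L^2(\Omega)$. Let $V:=H^1_0(\Omega)$, $a(v,\varphi):=\int_\Omega \kappa\,\nabla v\cdot\nabla\varphi\,dx$, and $f(\varphi):=\int_\Omega f\varphi\,dx$. The exact solution $u\in V$ is the unique element with $a(u,\varphi)=f(\varphi)$ for all $\varphi\in V$. The energy norm is $\|v\|_a:=\sqrt{a(v,v)}$. Let $\omega_1,\dots,\omega_{N_D}$ be open subdomains of $\Omega$ (an overlapping domain decomposition) with $\bigcup_{i=1}^{N_D}\omega_i=\Omega$. Put $O_i:=H^1_0(\omega_i)$, regarded as a subspace of $V$ by extension by zero and equipped with the energy inner product and norm. For $R\in V'$ let $\|R\|_{O_i'}:=\sup_{\varphi\in O_i\setminus\{0\}} R(\varphi)/\|\varphi\|_a$. Partition of unity. Let $\varrho_1,\dots,\varrho_{N_D}\in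 W^{1,\infty}(\Omega)$ satisfy $\sum_{i=1}^{N_D}\varrho_i\equiv 1$ on $\Omega$ and $\varrho_i\varphi\in O_i$ for all $\varphi\in V$ and all $i$. The constant $c_{pu}>0$ is defined by $$c_{pu}^2:=\sup_{\varphi\in V\setminus\{0\}}\frac{\sum_{i=1}^{N_D}\|\varrho_i\varphi\|_a^2}{\|\varphi\|_a^2}.$$ Residual based online enrichment algorithm. Start with $\widetilde V_0:=\{0\}$. For $n=0,1,2,\dots$: 1. Let $\widetilde u_n\in\widetilde V_n$ be the unique solution of $a(\widetilde u_n,\varphi)=f(\varphi)$ for all $\varphi\in\widetilde V_n$. 2. Let $R_n\in V'$, $R_n(\varphi):=f(\varphi)-a(\widetilde u_n,\varphi)$. 3. Choose $k\in\{1,\dots,N_D\}$ maximizing $\|R_n\|_{O_i'}$ over $i=1,\dots,N_D$ (any maximizer). 4. Let $\widehat u_n\in O_k$ be the unique solution of $a(\widehat u_n,\varphi)=R_n(\varphi)$ for all $\varphi\in O_k$. 5. Set $\widetilde V_{n+1}:=\widetilde V_n+\operatorname{span}\{\widehat u_n\}$. The stopping criterion is ignored, so the iteration is defined for all $n\ge 0$. *)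

theory Defs
  imports "HOL-Analysis.Analysis"
begin

text \<open>
  Elements of Lebesgue and Sobolev spaces over an open set \<open>\<Omega>\<close> are represented by functions on the
  whole Euclidean space whose values outside \<open>\<Omega>\<close> are irrelevant; two functions represent the same
  element iff they agree almost everywhere on \<open>\<Omega>\<close>. Each function space below is the set of all
  representatives of its elements, i.e. it is closed under almost everywhere equality on \<open>\<Omega>\<close>.
\<close>

definition ae_eq :: "'a::euclidean_space set \<Rightarrow> ('a \<Rightarrow> 'b) \<Rightarrow> ('a \<Rightarrow> 'b) \<Rightarrow> bool" where
  "ae_eq \<Omega> v w \<longleftrightarrow> (AE x in lebesgue_on \<Omega>. v x = w x)"

definition nonzero_elements :: "'a::euclidean_space set \<Rightarrow> ('a \<Rightarrow> real) set \<Rightarrow> ('a \<Rightarrow> real) set" where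
  "nonzero_elements \<Omega> W = {v \<in> W. \<not> ae_eq \<Omega> v (\<lambda>_. 0)}"

primrec C_k :: "nat \<Rightarrow> ('a::euclidean_space \<Rightarrow> real) \<Rightarrow> bool" where
  "C_k 0 = (\<lambda>f. continuous_on UNIV f)"
| "C_k (Suc k) = (\<lambda>f. (\<forall>x. f differentiable (at x)) \<and>
      (\<forall>b\<in>Basis. C_k k (\<lambda>x. frechet_derivative f (at x) b)))"

definition test_functions :: "'a::euclidean_space set \<Rightarrow> ('a \<Rightarrow> real) set" where
  "test_functions \<Omega> = {\<phi>. (\<forall>k. C_k k \<phi>) \<and>
      compact (closure {x. \<phi> x \<noteq> 0}) \<and> closure {x. \<phi> x \<noteq> 0} \<subseteq> \<Omega>}"

definition L2 :: "'a::euclidean_space set \<Rightarrow> ('a \<Rightarrow> 'b::euclidean_space) set" where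
  "L2 \<Omega> = {v. v \<in> borel_measurable (lebesgue_on \<Omega>) \<and>
      integrable (lebesgue_on \<Omega>) (\<lambda>x. (norm (v x))\<^sup>2)}"

definition Linf :: "'a::euclidean_space set \<Rightarrow> ('a \<Rightarrow> 'b::euclidean_space) set" where
  "Linf \<Omega> = {v. v \<in> borel_measurable (lebesgue_on \<Omega>) \<and>
      (\<exists>C. AE x in lebesgue_on \<Omega>. norm (v x) \<le> C)}"

definition locally_integrable :: "'a::euclidean_space set \<Rightarrow> ('a \<Rightarrow> 'b::euclidean_space) \<Rightarrow> bool" where
  "locally_integrable \<Omega> v \<longleftrightarrow> (\<forall>K. compact K \<and> K \<subseteq> \<Omega> \<longrightarrow> set_integrable lebesgue K v)"

definition has_weak_gradient ::
    "'a::euclidean_space set \<Rightarrow> ('a \<Rightarrow> real) \<Rightarrow> ('a \<Rightarrow> 'a) \<Rightarrow> bool" where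
  "has_weak_gradient \<Omega> v g \<longleftrightarrow> locally_integrable \<Omega> v \<and> locally_integrable \<Omega> g \<and>
     (\<forall>\<phi>\<in>test_functions \<Omega>. \<forall>b\<in>Basis.
        (LINT x|lebesgue_on \<Omega>. v x * frechet_derivative \<phi> (at x) b)
          = - (LINT x|lebesgue_on \<Omega>. (g x \<bullet> b) * \<phi> x))"

text \<open>The weak gradient is unique up to almost everywhere equality on \<open>\<Omega>\<close>.\<close>

definition weak_gradient :: "'a::euclidean_space set \<Rightarrow> ('a \<Rightarrow> real) \<Rightarrow> 'a \<Rightarrow> 'a" where
  "weak_gradient \<Omega> v = (SOME g. has_weak_gradient \<Omega> v g)"

definition H1 :: "'a::euclidean_space set \<Rightarrow> ('a \<Rightarrow> real) set" where
  "H1 \<Omega> = {v \<in> L2 \<Omega>. \<exists>g\<in>L2 \<Omega>. has_weak_gradient \<Omega> v g}"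

definition H1_norm :: "'a::euclidean_space set \<Rightarrow> ('a \<Rightarrow> real) \<Rightarrow> real" where
  "H1_norm \<Omega> v = sqrt ((LINT x|lebesgue_on \<Omega>. (v x)\<^sup>2)
     + (LINT x|lebesgue_on \<Omega>. (norm (weak_gradient \<Omega> v x))\<^sup>2))"

definition H10 :: "'a::euclidean_space set \<Rightarrow> ('a \<Rightarrow> real) set" where
  "H10 \<Omega> = {v \<in> H1 \<Omega>. \<forall>\<epsilon>>0. \<exists>\<phi>\<in>test_functions \<Omega>. H1_norm \<Omega> (\<lambda>x. v x - \<phi> x) < \<epsilon>}"

definition W1inf :: "'a::euclidean_space set \<Rightarrow> ('a \<Rightarrow> real) set" where
  "W1inf \<Omega> = {v \<in> Linf \<Omega>. \<exists>g\<in>Linf \<Omega>. has_weak_gradient \<Omega> v g}"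

text \<open>\<open>H\<^sup>1\<^sub>0(\<omega>)\<close>, embedded by extension by zero into the functions on \<open>\<Omega> \<supseteq> \<omega>\<close>.\<close>

definition H10_ext :: "'a::euclidean_space set \<Rightarrow> 'a set \<Rightarrow> ('a \<Rightarrow> real) set" where
  "H10_ext \<Omega> \<omega> = {v. \<exists>w\<in>H10 \<omega>. ae_eq \<Omega> v (\<lambda>x. if x \<in> \<omega> then w x else 0)}"

definition energy :: "'a::euclidean_space set \<Rightarrow> ('a \<Rightarrow> real) \<Rightarrow> ('a \<Rightarrow> real) \<Rightarrow> ('a \<Rightarrow> real) \<Rightarrow> real" where
  "energy \<Omega> \<kappa> v \<phi> =
     (LINT x|lebesgue_on \<Omega>. \<kappa> x * (weak_gradient \<Omega> v x \<bullet> weak_gradient \<Omega> \<phi> x))"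

definition energy_norm :: "'a::euclidean_space set \<Rightarrow> ('a \<Rightarrow> real) \<Rightarrow> ('a \<Rightarrow> real) \<Rightarrow> real" where
  "energy_norm \<Omega> \<kappa> v = sqrt (energy \<Omega> \<kappa> v v)"

definition load :: "'a::euclidean_space set \<Rightarrow> ('a \<Rightarrow> real) \<Rightarrow> ('a \<Rightarrow> real) \<Rightarrow> real" where
  "load \<Omega> f \<phi> = (LINT x|lebesgue_on \<Omega>. f x * \<phi> x)"

definition galerkin_solution :: "'a::euclidean_space set \<Rightarrow> ('a \<Rightarrow> real) \<Rightarrow>
    ('a \<Rightarrow> real) set \<Rightarrow> (('a \<Rightarrow> real) \<Rightarrow> real) \<Rightarrow> ('a \<Rightarrow> real) \<Rightarrow> bool" where
  "galerkin_solution \<Omega> \<kappa> W F u \<longleftrightarrow> u \<in> W \<and> (\<forall>\<phi>\<in>W. energy \<Omega> \<kappa> u \<phi> = F \<phi>)"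

definition dual_norm :: "'a::euclidean_space set \<Rightarrow> ('a \<Rightarrow> real) \<Rightarrow>
    ('a \<Rightarrow> real) set \<Rightarrow> (('a \<Rightarrow> real) \<Rightarrow> real) \<Rightarrow> real" where
  "dual_norm \<Omega> \<kappa> W R = (SUP \<phi>\<in>nonzero_elements \<Omega> W. R \<phi> / energy_norm \<Omega> \<kappa> \<phi>)"

definition c_pu :: "'a::euclidean_space set \<Rightarrow> ('a \<Rightarrow> real) \<Rightarrow> nat \<Rightarrow> (nat \<Rightarrow> 'a \<Rightarrow> real) \<Rightarrow> real" where
  "c_pu \<Omega> \<kappa> N \<rho> = sqrt (SUP \<phi>\<in>nonzero_elements \<Omega> (H10 \<Omega>).
      (\<Sum>i=1..N. (energy_norm \<Omega> \<kappa> (\<lambda>x. \<rho> i x * \<phi> x))\<^sup>2) / (energy_norm \<Omega> \<kappa> \<phi>)\<^sup>2)"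

definition residual :: "'a::euclidean_space set \<Rightarrow> ('a \<Rightarrow> real) \<Rightarrow> ('a \<Rightarrow> real) \<Rightarrow> ('a \<Rightarrow> real) \<Rightarrow>
    ('a \<Rightarrow> real) \<Rightarrow> real" where
  "residual \<Omega> \<kappa> f v \<phi> = load \<Omega> f \<phi> - energy \<Omega> \<kappa> v \<phi>"

text \<open>\<open>W + span {v}\<close>\<close>

definition add_span :: "'a::euclidean_space set \<Rightarrow> ('a \<Rightarrow> real) set \<Rightarrow> ('a \<Rightarrow> real) \<Rightarrow> ('a \<Rightarrow> real) set" where
  "add_span \<Omega> W v = {z. \<exists>w\<in>W. \<exists>c. ae_eq \<Omega> z (\<lambda>x. w x + c * v x)}"

definition online_enrichment :: "'a::euclidean_space set \<Rightarrow> ('a \<Rightarrow> real) \<Rightarrow> ('a \<Rightarrow> real) \<Rightarrow>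
    nat \<Rightarrow> (nat \<Rightarrow> 'a set) \<Rightarrow> (nat \<Rightarrow> ('a \<Rightarrow> real) set) \<Rightarrow> (nat \<Rightarrow> 'a \<Rightarrow> real) \<Rightarrow> bool" where
  "online_enrichment \<Omega> \<kappa> f N \<omega> Vr ur \<longleftrightarrow>
     Vr 0 = {v. ae_eq \<Omega> v (\<lambda>_. 0)} \<and>
     (\<forall>n. galerkin_solution \<Omega> \<kappa> (Vr n) (load \<Omega> f) (ur n) \<and>
        (\<exists>k\<in>{1..N}. \<exists>uh.
           (\<forall>i\<in>{1..N}. dual_norm \<Omega> \<kappa> (H10_ext \<Omega> (\<omega> i)) (residual \<Omega> \<kappa> f (ur n))
              \<le> dual_norm \<Omega> \<kappa> (H10_ext \<Omega> (\<omega> k)) (residual \<Omega> \<kappa> f (ur n))) \<and>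
           galerkin_solution \<Omega> \<kappa> (H10_ext \<Omega> (\<omega> k)) (residual \<Omega> \<kappa> f (ur n)) uh \<and>
           Vr (Suc n) = add_span \<Omega> (Vr n) uh))"

end

theory Submission
  imports Defs
begin

text \<open>
  Let \<open>e\<^sub>n = u - u\<^sub>n\<close> be the error and \<open>a\<close> the energy form. On \<open>H\<^sup>1\<^sub>0(\<Omega>)\<close> the residual is
  \<open>R\<^sub>n = a(e\<^sub>n, \<cdot>)\<close>, and the local solution \<open>r\<close> on the selected subdomain represents \<open>R\<^sub>n\<close> there.

  \<^item> Testing the Galerkin equation on the enlarged space, which contains \<open>u\<^sub>n + r\<close>, shows that
    \<open>a(e\<^sub>n\<^sub>+\<^sub>1, e\<^sub>n\<^sub>+\<^sub>1) \<le> a(e\<^sub>n - r, e\<^sub>n - r) = a(e\<^sub>n, e\<^sub>n) - a(r, r)\<close>.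
  \<^item> The energy norm of \<open>r\<close> is at least the largest local dual norm \<open>D\<close> of the residual
    (\<open>dual_norm_le_representer\<close>).
  \<^item> Splitting \<open>e\<^sub>n = \<Sum> \<rho>\<^sub>i e\<^sub>n\<close> gives \<open>a(e\<^sub>n, e\<^sub>n) = \<Sum> R\<^sub>n(\<rho>\<^sub>i e\<^sub>n) \<le> D \<Sum> \<parallel>\<rho>\<^sub>i e\<^sub>n\<parallel>\<close>, whence
    \<open>a(e\<^sub>n, e\<^sub>n) \<le> D\<^sup>2 N c\<^sub>p\<^sub>u\<^sup>2\<close> (\<open>energy_le_maximal_dual_norm\<close>).

  Together these yield the contraction factor \<open>1 - 1 / (N c\<^sub>p\<^sub>u\<^sup>2)\<close> for the squared norms.

  What remains is to justify the Hilbert space calculus on \<open>H\<^sup>1\<^sub>0\<close>. The energy form is bilinear because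
  weak gradients are unique almost everywhere, which is the fundamental lemma of the calculus of
  variations (\<open>fundamental_lemma\<close>), proved with explicit smooth bump functions on boxes. Elements of
  \<open>H\<^sup>1\<^sub>0\<close> are handled through pairs \<open>(v, g)\<close> that are \<open>L\<^sup>2\<close> limits of \<open>(\<phi>, \<nabla>\<phi>)\<close> for test functions
  \<open>\<phi>\<close> (\<open>H10_iff_H10_pair\<close>): vector space operations and extension by zero are immediate for such
  pairs, and the product rule follows by passing to the limit. Finally, the supremum that defines
  \<open>c\<^sub>p\<^sub>u\<close> is the true one only if the quotients are bounded above; this follows from the product rule
  and the Poincare inequality on the bounded domain (\<open>energy_norm_W1inf_mult_bounded\<close>).
\<close>

section \<open>Smooth functions and box-shaped bumps\<close>

abbreviation partial :: "('a::euclidean_space \<Rightarrow> real) \<Rightarrow> 'a \<Rightarrow> 'a \<Rightarrow> real" where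
  "partial f b x \<equiv> frechet_derivative f (at x) b"

lemma partial_eqI: "(f has_derivative D) (at x) \<Longrightarrow> partial f b x = D b"
  by (metis frechet_derivative_at)

lemma differentiable_imp_has_derivative:
  "f differentiable (at x) \<Longrightarrow> (f has_derivative frechet_derivative f (at x)) (at x)"
  by (simp add: frechet_derivative_works)

lemma C_k_Suc_imp_C_k: "C_k (Suc k) f \<Longrightarrow> C_k k f"
proof (induction k arbitrary: f)
  case 0
  then show ?case
    by (auto intro!: continuous_at_imp_continuous_on differentiable_imp_continuous_within)
next
  case (Suc k)
  then show ?case by auto
qed

lemma C_k_const: "C_k k (\<lambda>x. c)"
proof (induction k arbitrary: c)
  case (Suc k)
  then show ?case by (auto simp: frechet_derivative_const)
qed auto

lemma partial_add:
  assumes "f differentiable (at x)" "g differentiable (at x)"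
  shows "partial (\<lambda>x. f x + g x) b x = partial f b x + partial g b x"
  by (rule partial_eqI, rule has_derivative_add) (auto intro: differentiable_imp_has_derivative assms)

lemma partial_mult:
  assumes "f differentiable (at x)" "g differentiable (at x)"
  shows "partial (\<lambda>x. f x * g x) b x = f x * partial g b x + partial f b x * g x"
  by (rule partial_eqI, rule has_derivative_mult) (auto intro: differentiable_imp_has_derivative assms)

lemma partial_cmult:
  assumes "f differentiable (at x)"
  shows "partial (\<lambda>x. c * f x) b x = c * partial f b x"
  using partial_mult[of "\<lambda>_. c" x f b] assms by simp

lemma C_k_add: "C_k k f \<Longrightarrow> C_k k g \<Longrightarrow> C_k k (\<lambda>x. f x + g x)"
proof (induction k arbitrary: f g)
  case 0
  then show ?case by (auto intro!: continuous_intros)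
next
  case (Suc k)
  then have "(\<lambda>x. partial (\<lambda>x. f x + g x) b x) = (\<lambda>x. partial f b x + partial g b x)" for b
    by (auto simp: partial_add)
  with Suc show ?case by simp
qed

lemma C_k_mult: "C_k k f \<Longrightarrow> C_k k g \<Longrightarrow> C_k k (\<lambda>x. f x * g x)"
proof (induction k arbitrary: f g)
  case 0
  then show ?case by (auto intro!: continuous_intros)
next
  case (Suc k)
  then have "(\<lambda>x. partial (\<lambda>x. f x * g x) b x) = (\<lambda>x. f x * partial g b x + partial f b x * g x)" for b
    by (auto simp: partial_mult)
  moreover have "C_k k f" "C_k k g"
    using Suc.prems C_k_Suc_imp_C_k by blast+
  ultimately show ?case
    using Suc by (auto intro!: C_k_add)
qed

lemma C_k_prod:
  assumes "finite I" "\<And>i. i \<in> I \<Longrightarrow> C_k k (f i)"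
  shows "C_k k (\<lambda>x. \<Prod>i\<in>I. f i x)"
  using assms by (induction I rule: finite_induct) (auto intro: C_k_const C_k_mult)

text \<open>
  The functions \<open>P (1/t) * exp (-1/t)\<close>, extended by zero to \<open>t \<le> 0\<close>, are closed under
  differentiation, which makes each of them smooth.
\<close>

definition exp_flat :: "real poly \<Rightarrow> real \<Rightarrow> real" where
  "exp_flat P t = (if t > 0 then poly P (1 / t) * exp (- (1 / t)) else 0)"

lemma poly_times_exp_minus_tendsto_0: "((\<lambda>s. s ^ k * poly P s * exp (- s)) \<longlongrightarrow> (0::real)) at_top"
proof (induction P arbitrary: k)
  case (pCons a P)
  have "((\<lambda>s. a * (s ^ k / exp s) + s ^ Suc k * poly P s * exp (- s)) \<longlongrightarrow> a * 0 + 0) at_top"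
    by (intro tendsto_add tendsto_mult tendsto_const tendsto_power_div_exp_0 pCons.IH)
  then show ?case
    by (simp add: algebra_simps exp_minus divide_inverse)
qed simp

lemma exp_flat_tendsto_0: "(exp_flat P \<longlongrightarrow> 0) (at 0)"
proof -
  have "((\<lambda>t. poly P (inverse t) * exp (- (inverse t))) \<longlongrightarrow> 0) (at_right 0)"
    using filterlim_compose[OF poly_times_exp_minus_tendsto_0[of 0 P] filterlim_inverse_at_top_right]
    by simp
  then have "(exp_flat P \<longlongrightarrow> 0) (at_right 0)"
    by (rule Lim_transform_eventually)
       (auto simp: exp_flat_def eventually_at_right_less inverse_eq_divide
             intro!: eventually_at_rightI[of 0 1])
  moreover have "(exp_flat P \<longlongrightarrow> 0) (at_left 0)"
    by (rule tendsto_eventually) (auto simp: exp_flat_def intro!: eventually_at_leftI[of "-1"])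
  ultimately show ?thesis by (simp add: filterlim_split_at)
qed

lemma exp_flat_has_derivative:
  "(exp_flat P has_real_derivative exp_flat ([:0, 0, 1:] * (P - pderiv P)) t) (at t)"
proof -
  let ?Q = "[:0, 0, 1:] * (P - pderiv P)"
  consider "t > 0" | "t = 0" | "t < 0" by linarith
  then show ?thesis
  proof cases
    case 1
    have d: "((\<lambda>t. poly P (1 / t) * exp (- (1 / t))) has_real_derivative exp_flat ?Q t) (at t)"
    proof -
      have d: "((\<lambda>t. 1 / t) has_real_derivative - ((1 / t)\<^sup>2)) (at t)"
        using 1 by (auto intro!: derivative_eq_intros simp: power2_eq_square)
      have "((\<lambda>t. exp (- (1 / t))) has_real_derivative exp (- (1 / t)) * - (- ((1 / t)\<^sup>2))) (at t)"
        by (intro DERIV_fun_exp DERIV_minus d)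
      note DERIV_mult'[OF DERIV_chain2[OF poly_DERIV d, of P] this]
      moreover have "poly P s * (exp (- s) * - (- (s\<^sup>2))) + poly (pderiv P) s * - (s\<^sup>2) * exp (- s)
          = poly ?Q s * exp (- s)" for s :: real
        unfolding poly_mult poly_diff by (simp add: power2_eq_square, algebra)
      ultimately show ?thesis
        using 1 by (simp only: exp_flat_def if_True)
    qed
    have "eventually (\<lambda>s. s > 0) (nhds t)"
      using 1 by (intro eventually_nhds_in_open[of "{0<..}", simplified]) auto
    then have e: "eventually (\<lambda>s. poly P (1 / s) * exp (- (1 / s)) = exp_flat P s) (nhds t)"
      by eventually_elim (simp add: exp_flat_def)
    from d show ?thesis
      by (rule DERIV_cong_ev[OF refl e refl, THEN iffD1])
  next
    case 2
    \<comment> \<open>the difference quotient at \<open>0\<close> is again a function of the family\<close>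
    have "(\<lambda>h. (exp_flat P (0 + h) - exp_flat P 0) / h) = exp_flat ([:0, 1:] * P)"
      by (auto simp: exp_flat_def fun_eq_iff)
    then show ?thesis
      using exp_flat_tendsto_0[of "[:0, 1:] * P"] 2 by (simp add: DERIV_def exp_flat_def)
  next
    case 3
    have "eventually (\<lambda>s. s < 0) (nhds t)"
      using 3 by (intro eventually_nhds_in_open[of "{..<0}", simplified]) auto
    then have e: "eventually (\<lambda>s. 0 = exp_flat P s) (nhds t)"
      by eventually_elim (simp add: exp_flat_def)
    have d: "((\<lambda>t. 0) has_real_derivative exp_flat ?Q t) (at t)"
      using 3 by (simp add: exp_flat_def)
    from d show ?thesis
      by (rule DERIV_cong_ev[OF refl e refl, THEN iffD1])
  qed
qed

lemma exp_flat_affine_has_derivative: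
  fixes w :: "'a::euclidean_space"
  shows "((\<lambda>x. exp_flat P (x \<bullet> w + c)) has_derivative
     (\<lambda>h. exp_flat ([:0, 0, 1:] * (P - pderiv P)) (x \<bullet> w + c) * (h \<bullet> w))) (at x)"
  by (rule has_derivative_compose[OF _ exp_flat_has_derivative[unfolded has_field_derivative_def], of "\<lambda>x. x \<bullet> w + c"])
     (auto intro!: derivative_eq_intros)

lemma C_k_exp_flat_affine: "C_k k (\<lambda>x. exp_flat P (x \<bullet> w + c))"
proof (induction k arbitrary: P)
  case 0
  have "isCont (\<lambda>x. exp_flat P (x \<bullet> w + c)) x" for x
    by (rule has_derivative_continuous[OF exp_flat_affine_has_derivative])
  then show ?case by (simp add: continuous_at_imp_continuous_on)
next
  case (Suc k)
  have "(\<lambda>x. partial (\<lambda>x. exp_flat P (x \<bullet> w + c)) b x)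
     = (\<lambda>x. exp_flat ([:0, 0, 1:] * (P - pderiv P)) (x \<bullet> w + c) * (b \<bullet> w))" for b
    by (rule ext, rule partial_eqI[OF exp_flat_affine_has_derivative])
  then show ?case
    using exp_flat_affine_has_derivative Suc
    by (auto simp del: mult_pCons_left intro!: C_k_mult C_k_const simp: differentiable_def) blast
qed

text \<open>
  As \<open>n\<close> grows, these functions increase to the indicator of the open box; being supported in the
  closed box, they are the test functions that detect the integral over a box.
\<close>

definition box_bump :: "'a::euclidean_space \<Rightarrow> 'a \<Rightarrow> nat \<Rightarrow> 'a \<Rightarrow> real" where
  "box_bump a b n x = (\<Prod>i\<in>Basis. exp_flat 1 (x \<bullet> (real n *\<^sub>R i) + - (real n * (a \<bullet> i)))
                        * exp_flat 1 (x \<bullet> (- real n *\<^sub>R i) + real n * (b \<bullet> i)))"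

lemma C_k_box_bump: "C_k k (box_bump a b n)"
  unfolding box_bump_def[abs_def] by (intro C_k_prod C_k_mult C_k_exp_flat_affine) auto

lemma exp_flat_1_bounds: "0 \<le> exp_flat 1 t" "exp_flat 1 t \<le> 1"
  by (auto simp: exp_flat_def)

lemma box_bump_bounds: "0 \<le> box_bump a b n x" "box_bump a b n x \<le> 1"
  unfolding box_bump_def
  by (auto intro!: prod_nonneg prod_le_1 mult_nonneg_nonneg mult_le_one exp_flat_1_bounds)

lemma box_bump_outside:
  assumes "x \<notin> box a b"
  shows "box_bump a b n x = 0"
proof -
  obtain i where i: "i \<in> Basis" "x \<bullet> i \<le> a \<bullet> i \<or> b \<bullet> i \<le> x \<bullet> i"
    using assms by (auto simp: mem_box not_less)
  then have "exp_flat 1 (x \<bullet> (real n *\<^sub>R i) + - (real n * (a \<bullet> i)))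
                        * exp_flat 1 (x \<bullet> (- real n *\<^sub>R i) + real n * (b \<bullet> i)) = 0"
    by (auto simp: exp_flat_def mult_less_cancel_left_pos zero_less_mult_iff mult_less_cancel_left)
  then show ?thesis
    unfolding box_bump_def using i by (intro prod_zero) auto
qed

lemma box_bump_pos:
  assumes "x \<in> box a b" "n > 0"
  shows "box_bump a b n x > 0"
  unfolding box_bump_def using assms
  by (intro prod_pos) (auto simp: exp_flat_def mem_box)

lemma exp_flat_1_scaled_tendsto:
  assumes "t > 0"
  shows "(\<lambda>n. exp_flat 1 (real n * t)) \<longlonglongrightarrow> 1"
proof -
  have "(\<lambda>n. exp (- (inverse (real n) * (1 / t)))) \<longlonglongrightarrow> exp (- (0 * (1 / t)))"
    by (intro tendsto_intros lim_inverse_n)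
  then have "(\<lambda>n. exp (- (inverse (real n) * (1 / t)))) \<longlonglongrightarrow> 1" by simp
  then show ?thesis
    by (rule Lim_transform_eventually)
       (use assms in \<open>auto simp: exp_flat_def divide_simps intro!: eventually_sequentiallyI[of 1]\<close>)
qed

lemma box_bump_tendsto_indicator: "(\<lambda>n. box_bump a b n x) \<longlonglongrightarrow> indicator (box a b) x"
proof (cases "x \<in> box a b")
  case True
  have "(\<lambda>n. \<Prod>i\<in>Basis. exp_flat 1 (real n * (x \<bullet> i - a \<bullet> i)) * exp_flat 1 (real n * (b \<bullet> i - x \<bullet> i)))
     \<longlonglongrightarrow> (\<Prod>i\<in>(Basis::'a set). 1 * 1)"
    using True by (intro tendsto_prod tendsto_mult exp_flat_1_scaled_tendsto) (auto simp: mem_box)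
  then show ?thesis
    using True by (simp add: box_bump_def[abs_def] algebra_simps)
qed (simp add: box_bump_outside)

lemma box_bump_test_function:
  assumes "cbox a b \<subseteq> \<Omega>"
  shows "box_bump a b n \<in> test_functions \<Omega>"
proof -
  have sub: "{x. box_bump a b n x \<noteq> 0} \<subseteq> cbox a b"
    using box_bump_outside box_subset_cbox by blast
  then have "closure {x. box_bump a b n x \<noteq> 0} \<subseteq> cbox a b"
    by (rule closure_minimal) (rule closed_cbox)
  moreover have "compact (closure {x. box_bump a b n x \<noteq> 0})"
    using sub bounded_subset[OF bounded_cbox] by (simp only: compact_closure) blast
  ultimately show ?thesis
    using assms C_k_box_bump unfolding test_functions_def by blast
qed

section \<open>Integration by parts and the fundamental lemma of the calculus of variations\<close>

lemma continuous_compact_support_bounded: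
  fixes p :: "'a::euclidean_space \<Rightarrow> real"
  assumes "continuous_on UNIV p" "compact K" "\<And>x. x \<notin> K \<Longrightarrow> p x = 0"
  obtains B where "0 \<le> B" "\<And>x. \<bar>p x\<bar> \<le> B"
proof -
  have "bounded (p ` K)"
    using assms by (meson compact_continuous_image compact_imp_bounded continuous_on_subset subset_UNIV)
  then obtain B where B: "\<And>x. x \<in> K \<Longrightarrow> \<bar>p x\<bar> \<le> B"
    by (auto simp: bounded_iff)
  show ?thesis
  proof (rule that[of "max B 0"])
    show "\<bar>p x\<bar> \<le> max B 0" for x
      using B[of x] assms(3)[of x] by (cases "x \<in> K") (auto simp: max_def)
  qed simp
qed

lemma continuous_compact_support_integrable:
  fixes p :: "'a::euclidean_space \<Rightarrow> real"
  assumes "continuous_on UNIV p" "compact K" "\<And>x. x \<notin> K \<Longrightarrow> p x = 0"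
  shows "integrable lborel p"
proof -
  have "integrable lborel (\<lambda>x. indicator K x *\<^sub>R p x)"
    using assms by (intro borel_integrable_compact continuous_on_subset[OF assms(1)]) auto
  also have "(\<lambda>x. indicator K x *\<^sub>R p x) = p"
    using assms(3) by (auto simp: indicator_def fun_eq_iff)
  finally show ?thesis .
qed

lemma derivative_zero_outside_support:
  assumes "\<And>x. (F has_derivative F' x) (at x)" "compact K" "\<And>x. x \<notin> K \<Longrightarrow> F x = 0" "x \<notin> K"
  shows "F' x b = (0::real)"
proof -
  have "((\<lambda>_. 0) has_derivative F' x) (at x)"
    by (rule has_derivative_transform_within_open[OF assms(1), of "- K"])
       (use assms compact_imp_closed in auto)
  then have "F' x = (\<lambda>_. 0)"
    using has_derivative_const has_derivative_unique by blast
  then show ?thesis by simp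
qed

lemma lborel_integral_translate:
  fixes F :: "'a::euclidean_space \<Rightarrow> real"
  assumes [measurable]: "F \<in> borel_measurable borel" 
  shows "(LINT x|lborel. F (c + x)) = (LINT x|lborel. F x)"
proof -
  have "(LINT x|lborel. F (c + x)) = (LINT x|distr lborel borel ((+) c). F x)"
    by (subst integral_distr) auto
  then show ?thesis by (simp add: lborel_distr_plus)
qed

text \<open>
  The integral of a difference quotient vanishes because Lebesgue measure is translation invariant;
  the mean value theorem bounds the quotients uniformly, so the limit may be taken under the integral.
\<close>

lemma integral_directional_derivative_eq_0:
  fixes F :: "'a::euclidean_space \<Rightarrow> real"
  assumes F: "\<And>x. (F has_derivative F' x) (at x)"
    and cont: "continuous_on UNIV (\<lambda>x. F' x b)"
    and K: "compact K" "\<And>x. x \<notin> K \<Longrightarrow> F x = 0"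
  shows "(LINT x|lborel. F' x b) = 0"
proof -
  have F'0: "F' x b = 0" if "x \<notin> K" for x
    using derivative_zero_outside_support[OF F K that] .
  obtain B where B: "0 \<le> B" "\<And>x. \<bar>F' x b\<bar> \<le> B"
    using continuous_compact_support_bounded[OF cont K(1) F'0] by blast
  obtain r where r: "\<And>x. x \<in> K \<Longrightarrow> norm x \<le> r"
    using compact_imp_bounded[OF K(1)] by (auto simp: bounded_iff)
  have contF: "continuous_on UNIV F"
    by (intro continuous_at_imp_continuous_on ballI has_derivative_continuous[OF F])
  then have [measurable]: "F \<in> borel_measurable borel"
    by (rule borel_measurable_continuous_onI)
  have [measurable]: "(\<lambda>x. F' x b) \<in> borel_measurable borel"
    using cont by (rule borel_measurable_continuous_onI)
  have line: "((\<lambda>s. F (x + s *\<^sub>R b)) has_real_derivative F' (x + s *\<^sub>R b) b) (at s)" for x s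
  proof -
    have "((\<lambda>s. F (x + s *\<^sub>R b)) has_derivative (\<lambda>h. F' (x + s *\<^sub>R b) (h *\<^sub>R b))) (at s)"
      by (rule has_derivative_compose[OF _ F, of "\<lambda>s. x + s *\<^sub>R b"]) (auto intro!: derivative_eq_intros)
    moreover have "F' (x + s *\<^sub>R b) (h *\<^sub>R b) = F' (x + s *\<^sub>R b) b * h" for h
      using has_derivative_linear[OF F] by (simp add: linear_cmul mult.commute)
    ultimately show ?thesis by (simp add: has_field_derivative_def)
  qed
  define t :: "nat \<Rightarrow> real" where "t = (\<lambda>n. inverse (real (Suc n)))"
  have t: "0 < t n" "t n \<le> 1" for n
    by (auto simp: t_def field_simps)
  have t0: "filterlim t (at 0) sequentially"
    unfolding t_def filterlim_at using LIMSEQ_inverse_real_of_nat by auto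
  define D where "D = (\<lambda>n x. (F (t n *\<^sub>R b + x) - F x) / t n)"
  have lim: "(\<lambda>n. D n x) \<longlonglongrightarrow> F' x b" for x
  proof -
    have "((\<lambda>h. (F (x + h *\<^sub>R b) - F x) / h) \<longlongrightarrow> F' x b) (at 0)"
      using line[of x 0] by (simp add: DERIV_def)
    from filterlim_compose[OF this t0] show ?thesis
      by (simp add: D_def add.commute)
  qed
  have bound: "norm (D n x) \<le> B * indicator (cball 0 (r + norm b)) x" for n x
  proof (cases "x \<in> cball 0 (r + norm b)")
    case True
    have "\<exists>z>0. z < t n \<and> F (x + t n *\<^sub>R b) - F (x + 0 *\<^sub>R b) = (t n - 0) * F' (x + z *\<^sub>R b) b"
      by (rule MVT2[OF t(1)]) (rule line)
    then obtain z where "F (x + t n *\<^sub>R b) - F x = t n * F' (x + z *\<^sub>R b) b"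
      by auto
    then show ?thesis
      using B(2)[of "x + z *\<^sub>R b"] True t(1)[of n] by (simp add: D_def add.commute)
  next
    case False
    have "norm x \<le> norm (t n *\<^sub>R b + x) + norm (t n *\<^sub>R b)"
      by (metis add.commute add_diff_cancel_right' norm_triangle_ineq4)
    moreover have "norm (t n *\<^sub>R b) \<le> norm b"
      using t[of n] by (simp add: mult_left_le_one_le)
    ultimately have "t n *\<^sub>R b + x \<notin> K" "x \<notin> K"
      using False r[of "t n *\<^sub>R b + x"] r[of x] norm_ge_zero[of b] by auto
    then show ?thesis using False K(2) by (simp add: D_def)
  qed
  have "(\<lambda>n. LINT x|lborel. D n x) \<longlonglongrightarrow> (LINT x|lborel. F' x b)"
  proof (rule integral_dominated_convergence)
    have "integrable lborel (indicator (cball 0 (r + norm b)) :: 'a \<Rightarrow> real)"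
      by (rule integrable_real_indicator) (auto intro: emeasure_bounded_finite[unfolded infinity_ennreal_def])
    then show "integrable lborel (\<lambda>x::'a. B * indicator (cball 0 (r + norm b)) x)"
      by simp
  qed (use lim bound in \<open>auto simp: D_def\<close>)
  moreover have "(LINT x|lborel. D n x) = 0" for n
  proof -
    have int: "integrable lborel F"
      by (rule continuous_compact_support_integrable[OF contF K])
    have "integrable lborel (\<lambda>x. F (t n *\<^sub>R b + x))"
      using integrable_distr_eq[of "(+) (t n *\<^sub>R b)" lborel borel F] int
      by (simp add: lborel_distr_plus)
    then show ?thesis
      using int by (simp add: D_def lborel_integral_translate)
  qed
  ultimately show ?thesis
    by (simp add: LIMSEQ_const_iff)
qed

subsection \<open>Test functions\<close>

definition gradient :: "('a::euclidean_space \<Rightarrow> real) \<Rightarrow> 'a \<Rightarrow> 'a" where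
  "gradient \<phi> x = (\<Sum>b\<in>Basis. partial \<phi> b x *\<^sub>R b)"

lemma gradient_inner_Basis: "b \<in> Basis \<Longrightarrow> gradient \<phi> x \<bullet> b = partial \<phi> b x"
  by (simp add: gradient_def inner_sum_left_Basis)

lemma smooth_differentiable: "\<forall>k. C_k k \<phi> \<Longrightarrow> \<phi> differentiable (at x)"
  by (metis C_k.simps(2))

lemma smooth_continuous: "\<forall>k. C_k k \<phi> \<Longrightarrow> continuous_on UNIV \<phi>"
  by (metis C_k.simps(1))

lemma smooth_partial_continuous: "\<forall>k. C_k k \<phi> \<Longrightarrow> b \<in> Basis \<Longrightarrow> continuous_on UNIV (\<lambda>x. partial \<phi> b x)"
  using C_k.simps by metis

lemma smooth_gradient_continuous: "\<forall>k. C_k k \<phi> \<Longrightarrow> continuous_on UNIV (gradient \<phi>)"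
  unfolding gradient_def[abs_def]
  by (intro continuous_intros smooth_partial_continuous) auto

lemma test_function_smooth: "\<phi> \<in> test_functions \<Omega> \<Longrightarrow> \<forall>k. C_k k \<phi>"
  by (simp add: test_functions_def)

lemma test_function_support:
  assumes "\<phi> \<in> test_functions \<Omega>"
  obtains K where "compact K" "K \<subseteq> \<Omega>" "\<And>x. x \<notin> K \<Longrightarrow> \<phi> x = 0"
    "\<And>x b. x \<notin> K \<Longrightarrow> partial \<phi> b x = 0" "\<And>x. x \<notin> K \<Longrightarrow> gradient \<phi> x = 0"
proof -
  let ?K = "closure {x. \<phi> x \<noteq> 0}"
  have K: "compact ?K" "?K \<subseteq> \<Omega>"
    using assms by (auto simp: test_functions_def)
  have K0: "\<And>x. x \<notin> ?K \<Longrightarrow> \<phi> x = 0"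
    using closure_subset[of "{x. \<phi> x \<noteq> 0}"] by blast
  have d: "\<And>x. (\<phi> has_derivative frechet_derivative \<phi> (at x)) (at x)"
    using assms smooth_differentiable test_function_smooth differentiable_imp_has_derivative by blast
  have p: "partial \<phi> b x = 0" if "x \<notin> ?K" for x b
    using derivative_zero_outside_support[OF d K(1) K0 that] .
  have g: "gradient \<phi> x = 0" if "x \<notin> ?K" for x
    unfolding gradient_def using p[OF that] by simp
  show ?thesis by (rule that[OF K K0 p g])
qed

lemma test_functions_mono: "\<omega> \<subseteq> \<Omega> \<Longrightarrow> test_functions \<omega> \<subseteq> test_functions \<Omega>"
  by (auto simp: test_functions_def)

lemma compact_closure_subset:
  fixes K :: "'a::euclidean_space set"
  shows "compact K \<Longrightarrow> closure S \<subseteq> K \<Longrightarrow> compact (closure S)"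
  using compact_eq_bounded_closed bounded_subset[of K "closure S"] by blast

lemma test_functions_smooth_mult:
  assumes "\<forall>k. C_k k f" "\<psi> \<in> test_functions \<Omega>"
  shows "(\<lambda>x. f x * \<psi> x) \<in> test_functions \<Omega>"
proof -
  have sub: "closure {x. f x * \<psi> x \<noteq> 0} \<subseteq> closure {x. \<psi> x \<noteq> 0}"
    by (rule closure_mono) auto
  moreover have "compact (closure {x. \<psi> x \<noteq> 0})"
    using assms(2) by (simp add: test_functions_def)
  ultimately have "compact (closure {x. f x * \<psi> x \<noteq> 0})"
    by (rule compact_closure_subset[rotated])
  then show ?thesis
    using assms sub unfolding test_functions_def by (auto intro: C_k_mult)
qed

lemma test_functions_add:
  assumes "\<phi> \<in> test_functions \<Omega>" "\<psi> \<in> test_functions \<Omega>"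
  shows "(\<lambda>x. \<phi> x + \<psi> x) \<in> test_functions \<Omega>"
proof -
  let ?K = "closure {x. \<phi> x \<noteq> 0} \<union> closure {x. \<psi> x \<noteq> 0}"
  have sub: "closure {x. \<phi> x + \<psi> x \<noteq> 0} \<subseteq> ?K"
    unfolding closure_Un[symmetric] by (rule closure_mono) auto
  moreover have K: "compact ?K" "?K \<subseteq> \<Omega>"
    using assms by (auto simp: test_functions_def)
  ultimately have "compact (closure {x. \<phi> x + \<psi> x \<noteq> 0})"
    using compact_closure_subset by blast
  then show ?thesis
    using assms sub K(2) unfolding test_functions_def by (auto intro: C_k_add)
qed

lemma zero_test_function: "(\<lambda>x. 0) \<in> test_functions \<Omega>"
  by (simp add: test_functions_def C_k_const)

lemma gradient_add:
  "\<forall>k. C_k k \<phi> \<Longrightarrow> \<forall>k. C_k k \<psi> \<Longrightarrow> gradient (\<lambda>x. \<phi> x + \<psi> x) x = gradient \<phi> x + gradient \<psi> x"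
  by (simp add: gradient_def partial_add smooth_differentiable scaleR_add_left sum.distrib)

lemma gradient_cmult:
  "\<forall>k. C_k k \<phi> \<Longrightarrow> gradient (\<lambda>x. c * \<phi> x) x = c *\<^sub>R gradient \<phi> x"
  by (simp add: gradient_def partial_cmult smooth_differentiable scaleR_sum_right)

lemma smooth_borel_measurable:
  "\<forall>k. C_k k \<phi> \<Longrightarrow> \<phi> \<in> borel_measurable borel"
  "\<forall>k. C_k k \<phi> \<Longrightarrow> b \<in> Basis \<Longrightarrow> (\<lambda>x. partial \<phi> b x) \<in> borel_measurable borel"
  "\<forall>k. C_k k \<phi> \<Longrightarrow> gradient \<phi> \<in> borel_measurable borel"
  by (rule borel_measurable_continuous_onI;
      rule smooth_continuous smooth_partial_continuous smooth_gradient_continuous; assumption)+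

lemma test_function_integration_by_parts:
  assumes \<phi>: "\<forall>k. C_k k \<phi>" and \<psi>: "\<psi> \<in> test_functions \<Omega>" and b: "b \<in> Basis"
  shows "(LINT x|lborel. \<phi> x * partial \<psi> b x) = - (LINT x|lborel. partial \<phi> b x * \<psi> x)"
proof -
  obtain K where K: "compact K" "\<And>x. x \<notin> K \<Longrightarrow> \<psi> x = 0" "\<And>x b. x \<notin> K \<Longrightarrow> partial \<psi> b x = 0"
    using test_function_support[OF \<psi>] by metis
  note \<psi>s = test_function_smooth[OF \<psi>]
  note cont = smooth_continuous[OF \<phi>] smooth_continuous[OF \<psi>s]
    smooth_partial_continuous[OF \<phi> b] smooth_partial_continuous[OF \<psi>s b]
  have "((\<lambda>x. \<phi> x * \<psi> x) has_derivative
      (\<lambda>h. \<phi> x * partial \<psi> h x + partial \<phi> h x * \<psi> x)) (at x)" for x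
    by (intro has_derivative_mult differentiable_imp_has_derivative smooth_differentiable \<phi> \<psi>s)
  then have "(LINT x|lborel. \<phi> x * partial \<psi> b x + partial \<phi> b x * \<psi> x) = 0"
    by (rule integral_directional_derivative_eq_0[where K = K])
       (use K in \<open>auto intro!: continuous_intros cont\<close>)
  moreover have "integrable lborel (\<lambda>x. \<phi> x * partial \<psi> b x)" "integrable lborel (\<lambda>x. partial \<phi> b x * \<psi> x)"
    by (rule continuous_compact_support_integrable[where K = K];
        use K in \<open>auto intro!: continuous_intros cont\<close>)+
  ultimately show ?thesis by simp
qed

subsection \<open>Integration against test functions\<close>

lemma integral_lebesgue_on_vanishing:
  fixes F :: "'a::euclidean_space \<Rightarrow> 'b::{banach, second_countable_topology}"
  assumes "\<Omega> \<in> sets lebesgue" "\<And>x. x \<notin> \<Omega> \<Longrightarrow> F x = 0"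
  shows "(LINT x|lebesgue_on \<Omega>. F x) = (LINT x|lebesgue. F x)"
    and "integrable (lebesgue_on \<Omega>) F \<longleftrightarrow> integrable lebesgue F"
proof -
  have "(\<lambda>x. indicator \<Omega> x *\<^sub>R F x) = F"
    using assms(2) by (auto simp: indicator_def fun_eq_iff)
  then show "(LINT x|lebesgue_on \<Omega>. F x) = (LINT x|lebesgue. F x)"
    "integrable (lebesgue_on \<Omega>) F \<longleftrightarrow> integrable lebesgue F"
    using assms(1) by (simp_all add: integral_restrict_space integrable_restrict_space)
qed

lemma borel_measurable_lebesgue_onI:
  "F \<in> borel_measurable borel \<Longrightarrow> F \<in> borel_measurable (lebesgue_on \<Omega>)"
  by (intro measurable_restrict_space1 measurable_completion) simp

lemma locally_integrable_times_continuous: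
  fixes g :: "'a::euclidean_space \<Rightarrow> 'b::euclidean_space"
  assumes \<Omega>: "\<Omega> \<in> sets lebesgue" and g: "locally_integrable \<Omega> g"
    and p: "continuous_on UNIV p" and K: "compact K" "K \<subseteq> \<Omega>" "\<And>x. x \<notin> K \<Longrightarrow> p x = 0"
  shows "integrable (lebesgue_on \<Omega>) (\<lambda>x. p x *\<^sub>R g x)"
proof -
  obtain B where B: "0 \<le> B" "\<And>x. \<bar>p x\<bar> \<le> B"
    using continuous_compact_support_bounded[OF p K(1,3)] by blast
  have int: "integrable lebesgue (\<lambda>x. indicator K x *\<^sub>R g x)"
    using g K unfolding locally_integrable_def set_integrable_def by blast
  have [measurable]: "p \<in> borel_measurable lebesgue"
    using p by (intro measurable_completion) (simp add: borel_measurable_continuous_onI)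
  have "integrable lebesgue (\<lambda>x. p x *\<^sub>R (indicator K x *\<^sub>R g x))"
  proof (rule Bochner_Integration.integrable_bound)
    show "integrable lebesgue (\<lambda>x. B *\<^sub>R (indicator K x *\<^sub>R g x))"
      using int by (rule integrable_scaleR_right)
    show "(\<lambda>x. p x *\<^sub>R (indicator K x *\<^sub>R g x)) \<in> borel_measurable lebesgue"
      using borel_measurable_integrable[OF int] by measurable
    show "AE x in lebesgue. norm (p x *\<^sub>R (indicator K x *\<^sub>R g x)) \<le> norm (B *\<^sub>R (indicator K x *\<^sub>R g x))"
      by (intro AE_I2) (auto simp: indicator_def mult_right_mono B)
  qed
  also have "(\<lambda>x. p x *\<^sub>R (indicator K x *\<^sub>R g x)) = (\<lambda>x. p x *\<^sub>R g x)"
    using K(3) by (auto simp: indicator_def fun_eq_iff)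
  finally show ?thesis
    using K by (subst integral_lebesgue_on_vanishing(2)[OF \<Omega>]) auto
qed

text \<open>
  The bumps converge to the indicator of the open box, and the boundary of a box is a null set.
\<close>

lemma set_integral_box_eq_0:
  fixes h :: "'a::euclidean_space \<Rightarrow> real"
  assumes \<Omega>: "\<Omega> \<in> sets lebesgue" and h: "locally_integrable \<Omega> h"
    and 0: "\<And>\<phi>. \<phi> \<in> test_functions \<Omega> \<Longrightarrow> (LINT x|lebesgue_on \<Omega>. h x * \<phi> x) = 0"
    and sub: "cbox a b \<subseteq> \<Omega>"
  shows "integral (cbox a b) h = 0"
proof -
  define H where "H = (\<lambda>x. indicator (cbox a b) x * h x)"
  have int: "integrable lebesgue H"
    using h sub unfolding locally_integrable_def set_integrable_def H_def by simp
  have bump: "box_bump a b n x = 0" if "x \<notin> cbox a b" for n x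
    using that box_bump_outside box_subset_cbox by blast
  have [measurable]: "box_bump a b n \<in> borel_measurable lebesgue" for n
    by (intro measurable_completion) (simp add: smooth_borel_measurable C_k_box_bump)
  have [measurable]: "H \<in> borel_measurable lebesgue"
    by (rule borel_measurable_integrable[OF int])
  have [measurable]: "box a b \<in> sets lebesgue" by simp
  have "(\<lambda>n. LINT x|lebesgue. box_bump a b n x * H x)
      \<longlonglongrightarrow> (LINT x|lebesgue. indicator (box a b) x * H x)"
  proof (rule integral_dominated_convergence)
    show "integrable lebesgue (\<lambda>x. norm (H x))" using int by (rule integrable_norm)
    show "AE x in lebesgue. (\<lambda>n. box_bump a b n x * H x) \<longlonglongrightarrow> indicator (box a b) x * H x"
      by (intro AE_I2 tendsto_mult box_bump_tendsto_indicator tendsto_const)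
    show "AE x in lebesgue. norm (box_bump a b n x * H x) \<le> norm (H x)" for n
      by (intro AE_I2) (simp add: abs_mult mult_left_le_one_le box_bump_bounds)
  qed (measurable, measurable)
  moreover have "(LINT x|lebesgue. box_bump a b n x * H x) = 0" for n
  proof -
    have "(LINT x|lebesgue. box_bump a b n x * H x) = (LINT x|lebesgue. h x * box_bump a b n x)"
      by (rule Bochner_Integration.integral_cong) (auto simp: H_def indicator_def bump)
    also have "\<dots> = (LINT x|lebesgue_on \<Omega>. h x * box_bump a b n x)"
      using bump sub by (intro integral_lebesgue_on_vanishing(1)[symmetric] \<Omega>) auto
    also have "\<dots> = 0"
      by (intro 0 box_bump_test_function sub)
    finally show ?thesis .
  qed
  ultimately have "(LINT x|lebesgue. indicator (box a b) x * H x) = 0"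
    by (simp add: LIMSEQ_const_iff)
  also have "(LINT x|lebesgue. indicator (box a b) x * H x) = (LINT x|lebesgue. H x)"
  proof (rule integral_cong_AE)
    have "AE x in lebesgue. x \<notin> cbox a b - box a b"
      using negligible_frontier_interval[of a b] unfolding negligible_iff_null_sets by (rule AE_not_in)
    then show "AE x in lebesgue. indicator (box a b) x * H x = H x"
      by eventually_elim (auto simp: H_def indicator_def)
  qed measurable
  also have "\<dots> = (LINT x:cbox a b|lebesgue. h x)"
    by (simp add: H_def set_lebesgue_integral_def)
  also have "\<dots> = integral (cbox a b) h"
    using h sub by (intro set_lebesgue_integral_eq_integral) (auto simp: locally_integrable_def)
  finally show ?thesis by simp
qed

text \<open>
  A function whose integrals over all small boxes vanish is zero at each of its Lebesgue points.
\<close>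

lemma fundamental_lemma:
  fixes h :: "'a::euclidean_space \<Rightarrow> real"
  assumes \<Omega>: "open \<Omega>" and h: "locally_integrable \<Omega> h"
    and 0: "\<And>\<phi>. \<phi> \<in> test_functions \<Omega> \<Longrightarrow> (LINT x|lebesgue_on \<Omega>. h x * \<phi> x) = 0"
  shows "AE x in lebesgue_on \<Omega>. h x = 0"
proof -
  have \<Omega>': "\<Omega> \<in> sets lebesgue" using \<Omega> by simp
  have *: "AE x in lebesgue. x \<in> cbox c d \<longrightarrow> h x = 0" if cd: "cbox c d \<subseteq> \<Omega>" for c d
  proof -
    define H where "H = (\<lambda>x. if x \<in> cbox c d then h x else 0)"
    have "set_integrable lebesgue (cbox c d) h"
      using h cd by (auto simp: locally_integrable_def)
    then have "h integrable_on cbox c d"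
      by (rule set_lebesgue_integral_eq_integral(1))
    then have "H integrable_on UNIV"
      by (simp add: H_def integrable_restrict_UNIV)
    then have int: "H integrable_on cbox a b" for a b
      by (rule integrable_on_subcbox) simp
    have zero: "integral (cbox a b) H = 0" for a b
    proof -
      obtain e f where ef: "cbox a b \<inter> cbox c d = cbox e f"
        using Int_interval by blast
      have "integral (cbox a b) H = integral (cbox e f) h"
        unfolding H_def ef[symmetric] by (metis Int_commute integral_restrict_Int)
      also have "\<dots> = 0"
        using ef cd by (intro set_integral_box_eq_0[OF \<Omega>' h 0]) auto
      finally show ?thesis .
    qed
    obtain N where N: "negligible N" "\<And>x e. x \<notin> N \<Longrightarrow> 0 < e \<Longrightarrow>
        \<exists>d>0. \<forall>h. 0 < h \<and> h < d \<longrightarrow>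
          norm (integral (cbox x (x + h *\<^sub>R One)) H /\<^sub>R h ^ DIM('a) - H x) < e"
      using integrable_ccontinuous_explicit[of H] int by blast
    have H0: "H x = 0" if xN: "x \<notin> N" for x
    proof (rule ccontr)
      assume "H x \<noteq> 0"
      then have "\<exists>d>0. \<forall>h. \<not> (0 < h \<and> h < (d::real))"
        using N(2)[OF xN, of "\<bar>H x\<bar>"] by (simp add: zero)
      then show False by (meson dense)
    qed
    have "AE x in lebesgue. x \<notin> N"
      using N(1) by (simp add: negligible_iff_null_sets AE_not_in)
    then show ?thesis
      by eventually_elim (use H0 in \<open>force simp: H_def\<close>)
  qed
  obtain \<D> where D: "countable \<D>" "\<D> \<subseteq> Pow \<Omega>" "\<And>X. X \<in> \<D> \<Longrightarrow> \<exists>a b. X = cbox a b" "\<Union>\<D> = \<Omega>"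
    using open_countable_Union_open_cbox[OF \<Omega>] by blast
  have "AE x in lebesgue. \<forall>X\<in>\<D>. x \<in> X \<longrightarrow> h x = 0"
    using D(1)
  proof (rule AE_ball_countable[THEN iffD2], intro ballI)
    fix X assume "X \<in> \<D>"
    with D(2,3) obtain a b where "X = cbox a b" "cbox a b \<subseteq> \<Omega>" by blast
    then show "AE x in lebesgue. x \<in> X \<longrightarrow> h x = 0" using * by blast
  qed
  then have "AE x in lebesgue. x \<in> \<Omega> \<longrightarrow> h x = 0"
    by eventually_elim (use D(4) in blast)
  then show ?thesis
    using \<Omega>' by (simp add: AE_restrict_space_iff)
qed

section \<open>Square integrable functions\<close>

lemma borel_measurable_lebesgue_on_AE:
  fixes f g :: "'a::euclidean_space \<Rightarrow> 'b::euclidean_space"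
  assumes \<Omega>: "\<Omega> \<in> sets lebesgue" and f: "f \<in> borel_measurable (lebesgue_on \<Omega>)"
    and eq: "AE x in lebesgue_on \<Omega>. f x = g x"
  shows "g \<in> borel_measurable (lebesgue_on \<Omega>)"
proof -
  have "AE x in lebesgue. x \<in> \<Omega> \<longrightarrow> f x = g x"
    using eq \<Omega> by (simp add: AE_restrict_space_iff)
  then have "AE x in lebesgue. (if x \<in> \<Omega> then f x else 0) = (if x \<in> \<Omega> then g x else 0)"
    by eventually_elim simp
  from borel_measurable_AE[OF borel_measurable_if_I[OF f \<Omega>] this] show ?thesis
    using \<Omega> by (simp add: borel_measurable_if)
qed

lemma integrable_lebesgue_on_AE:
  fixes f g :: "'a::euclidean_space \<Rightarrow> 'b::euclidean_space"
  assumes "\<Omega> \<in> sets lebesgue" "integrable (lebesgue_on \<Omega>) f" "AE x in lebesgue_on \<Omega>. f x = g x"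
  shows "integrable (lebesgue_on \<Omega>) g"
  using assms borel_measurable_lebesgue_on_AE[OF assms(1) _ assms(3)] borel_measurable_integrable
  by (metis integrable_cong_AE_imp)

lemma integral_lebesgue_on_AE:
  fixes f g :: "'a::euclidean_space \<Rightarrow> 'b::euclidean_space"
  assumes "\<Omega> \<in> sets lebesgue" "integrable (lebesgue_on \<Omega>) f" "AE x in lebesgue_on \<Omega>. f x = g x"
  shows "(LINT x|lebesgue_on \<Omega>. f x) = (LINT x|lebesgue_on \<Omega>. g x)"
  using borel_measurable_lebesgue_on_AE[OF assms(1) _ assms(3)] borel_measurable_integrable[OF assms(2)]
  by (intro integral_cong_AE assms(3)) auto

definition L2_inner :: "'a::euclidean_space set \<Rightarrow> ('a \<Rightarrow> 'b::euclidean_space) \<Rightarrow> ('a \<Rightarrow> 'b) \<Rightarrow> real" where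
  "L2_inner \<Omega> v w = (LINT x|lebesgue_on \<Omega>. v x \<bullet> w x)"

definition L2_norm :: "'a::euclidean_space set \<Rightarrow> ('a \<Rightarrow> 'b::euclidean_space) \<Rightarrow> real" where
  "L2_norm \<Omega> v = sqrt (L2_inner \<Omega> v v)"

lemma L2_measurable [measurable_dest]: "v \<in> L2 \<Omega> \<Longrightarrow> v \<in> borel_measurable (lebesgue_on \<Omega>)"
  by (simp add: L2_def)

lemma L2_scaleR: "v \<in> L2 \<Omega> \<Longrightarrow> (\<lambda>x. c *\<^sub>R v x) \<in> L2 \<Omega>"
  by (auto simp: L2_def power_mult_distrib)

lemma L2_cmult: "v \<in> L2 \<Omega> \<Longrightarrow> (\<lambda>x. c * v x :: real) \<in> L2 \<Omega>"
  using L2_scaleR[of v \<Omega> c] by simp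

lemma L2_add:
  assumes v: "v \<in> L2 \<Omega>" and w: "w \<in> L2 \<Omega>"
  shows "(\<lambda>x. v x + w x) \<in> L2 \<Omega>"
proof -
  note [measurable] = L2_measurable[OF v] L2_measurable[OF w]
  have "integrable (lebesgue_on \<Omega>) (\<lambda>x. (norm (v x + w x))\<^sup>2)"
  proof (rule Bochner_Integration.integrable_bound)
    show "integrable (lebesgue_on \<Omega>) (\<lambda>x. 2 * (norm (v x))\<^sup>2 + 2 * (norm (w x))\<^sup>2)"
      using v w by (auto simp: L2_def)
    have "(norm (v x + w x))\<^sup>2 \<le> 2 * (norm (v x))\<^sup>2 + 2 * (norm (w x))\<^sup>2" for x
    proof -
      have "(norm (v x + w x))\<^sup>2 \<le> (norm (v x) + norm (w x))\<^sup>2"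
        by (intro power_mono norm_triangle_ineq) auto
      then show ?thesis
        using sum_squares_bound[of "norm (v x)" "norm (w x)"] by (simp add: power2_sum)
    qed
    then show "AE x in lebesgue_on \<Omega>. norm ((norm (v x + w x))\<^sup>2) \<le> norm (2 * (norm (v x))\<^sup>2 + 2 * (norm (w x))\<^sup>2)"
      by simp
  qed measurable
  then show ?thesis by (simp add: L2_def)
qed

lemma L2_diff: "v \<in> L2 \<Omega> \<Longrightarrow> w \<in> L2 \<Omega> \<Longrightarrow> (\<lambda>x. v x - w x) \<in> L2 \<Omega>"
  using L2_add[OF _ L2_scaleR, of v \<Omega> w "-1"] by simp

lemma L2_AE:
  assumes "\<Omega> \<in> sets lebesgue" "v \<in> L2 \<Omega>" "AE x in lebesgue_on \<Omega>. v x = w x"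
  shows "w \<in> L2 \<Omega>"
proof -
  have "AE x in lebesgue_on \<Omega>. (norm (v x))\<^sup>2 = (norm (w x))\<^sup>2"
    using assms(3) by eventually_elim simp
  moreover have "integrable (lebesgue_on \<Omega>) (\<lambda>x. (norm (v x))\<^sup>2)"
    using assms(2) by (simp add: L2_def)
  ultimately have "integrable (lebesgue_on \<Omega>) (\<lambda>x. (norm (w x))\<^sup>2)"
    by (rule integrable_lebesgue_on_AE[OF assms(1), rotated])
  then show ?thesis
    using borel_measurable_lebesgue_on_AE[OF assms(1) L2_measurable[OF assms(2)] assms(3)]
    by (simp add: L2_def)
qed

lemma L2_bounded_scaleR:
  assumes p: "p \<in> Linf \<Omega>" and v: "v \<in> L2 \<Omega>"
  shows "(\<lambda>x. p x *\<^sub>R v x) \<in> L2 \<Omega>"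
proof -
  from p obtain C where C: "AE x in lebesgue_on \<Omega>. norm (p x) \<le> C"
    and [measurable]: "p \<in> borel_measurable (lebesgue_on \<Omega>)"
    by (auto simp: Linf_def)
  note [measurable] = L2_measurable[OF v]
  have "integrable (lebesgue_on \<Omega>) (\<lambda>x. (norm (p x *\<^sub>R v x))\<^sup>2)"
  proof (rule Bochner_Integration.integrable_bound)
    show "integrable (lebesgue_on \<Omega>) (\<lambda>x. C\<^sup>2 * (norm (v x))\<^sup>2)"
      using v by (auto simp: L2_def)
    show "AE x in lebesgue_on \<Omega>. norm ((norm (p x *\<^sub>R v x))\<^sup>2) \<le> norm (C\<^sup>2 * (norm (v x))\<^sup>2)"
      using C
    proof eventually_elim
      case (elim x)
      then have "\<bar>p x\<bar>\<^sup>2 \<le> C\<^sup>2" by (intro power_mono) auto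
      then show ?case by (simp add: power_mult_distrib mult_right_mono)
    qed
  qed measurable
  then show ?thesis by (simp add: L2_def)
qed

lemma L2_bounded_swap:
  fixes r :: "'a::euclidean_space \<Rightarrow> 'b::euclidean_space"
  assumes r: "r \<in> Linf \<Omega>" and v: "v \<in> L2 \<Omega>"
  shows "(\<lambda>x. v x *\<^sub>R r x) \<in> L2 \<Omega>"
proof -
  from r have n: "(\<lambda>x. norm (r x)) \<in> Linf \<Omega>" and [measurable]: "r \<in> borel_measurable (lebesgue_on \<Omega>)"
    by (auto simp: Linf_def)
  note [measurable] = L2_measurable[OF v]
  have "(\<lambda>x. v x *\<^sub>R r x) \<in> borel_measurable (lebesgue_on \<Omega>)" by measurable
  with L2_bounded_scaleR[OF n v] show ?thesis
    by (simp add: L2_def power_mult_distrib mult.commute)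
qed

lemma L2_inner_integrable:
  assumes v: "v \<in> L2 \<Omega>" and w: "w \<in> L2 \<Omega>"
  shows "integrable (lebesgue_on \<Omega>) (\<lambda>x. v x \<bullet> w x)"
proof (rule Bochner_Integration.integrable_bound)
  note [measurable] = L2_measurable[OF v] L2_measurable[OF w]
  show "integrable (lebesgue_on \<Omega>) (\<lambda>x. (norm (v x))\<^sup>2 + (norm (w x))\<^sup>2)"
    using v w by (auto simp: L2_def)
  have "\<bar>v x \<bullet> w x\<bar> \<le> (norm (v x))\<^sup>2 + (norm (w x))\<^sup>2" for x
    using Cauchy_Schwarz_ineq2[of "v x" "w x"] sum_squares_bound[of "norm (v x)" "norm (w x)"]
      norm_ge_zero[of "v x"] norm_ge_zero[of "w x"] mult_nonneg_nonneg[of "norm (v x)" "norm (w x)"]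
    by linarith
  then show "AE x in lebesgue_on \<Omega>. norm (v x \<bullet> w x) \<le> norm ((norm (v x))\<^sup>2 + (norm (w x))\<^sup>2)"
    by simp
  show "(\<lambda>x. v x \<bullet> w x) \<in> borel_measurable (lebesgue_on \<Omega>)" by measurable
qed

lemma L2_inner_commute: "L2_inner \<Omega> v w = L2_inner \<Omega> w v"
  by (simp add: L2_inner_def inner_commute)

lemma L2_inner_add_left:
  "\<lbrakk>v \<in> L2 \<Omega>; v' \<in> L2 \<Omega>; w \<in> L2 \<Omega>\<rbrakk> \<Longrightarrow> L2_inner \<Omega> (\<lambda>x. v x + v' x) w = L2_inner \<Omega> v w + L2_inner \<Omega> v' w"
  by (simp add: L2_inner_def inner_add_left L2_inner_integrable)

lemma L2_inner_diff_left:
  "\<lbrakk>v \<in> L2 \<Omega>; v' \<in> L2 \<Omega>; w \<in> L2 \<Omega>\<rbrakk> \<Longrightarrow> L2_inner \<Omega> (\<lambda>x. v x - v' x) w = L2_inner \<Omega> v w - L2_inner \<Omega> v' w"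
  by (simp add: L2_inner_def inner_diff_left L2_inner_integrable)

lemma L2_inner_scaleR_left: "L2_inner \<Omega> (\<lambda>x. c *\<^sub>R v x) w = c * L2_inner \<Omega> v w"
  by (simp add: L2_inner_def)

lemma L2_inner_self: "L2_inner \<Omega> v v = (LINT x|lebesgue_on \<Omega>. (norm (v x))\<^sup>2)"
  by (simp add: L2_inner_def dot_square_norm)

lemma L2_inner_self_nonneg: "0 \<le> L2_inner \<Omega> v v"
  by (simp add: L2_inner_self)

lemma L2_norm_nonneg: "0 \<le> L2_norm \<Omega> v"
  by (simp add: L2_norm_def L2_inner_self_nonneg)

lemma L2_norm_square: "(L2_norm \<Omega> v)\<^sup>2 = L2_inner \<Omega> v v"
  by (simp add: L2_norm_def L2_inner_self_nonneg)

lemma L2_norm_scaleR: "L2_norm \<Omega> (\<lambda>x. c *\<^sub>R v x) = \<bar>c\<bar> * L2_norm \<Omega> v"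
  by (simp add: L2_norm_def L2_inner_def real_sqrt_mult mult.assoc[symmetric])

lemma L2_inner_AE:
  assumes "\<Omega> \<in> sets lebesgue" "v \<in> L2 \<Omega>" "w \<in> L2 \<Omega>"
    "AE x in lebesgue_on \<Omega>. v x = v' x" "AE x in lebesgue_on \<Omega>. w x = w' x"
  shows "L2_inner \<Omega> v w = L2_inner \<Omega> v' w'"
proof -
  have "AE x in lebesgue_on \<Omega>. v x \<bullet> w x = v' x \<bullet> w' x"
    using assms(4,5) by eventually_elim simp
  then show ?thesis
    unfolding L2_inner_def
    by (intro integral_lebesgue_on_AE[OF assms(1)] L2_inner_integrable assms)
qed

lemma L2_norm_AE:
  assumes "\<Omega> \<in> sets lebesgue" "v \<in> L2 \<Omega>" "AE x in lebesgue_on \<Omega>. v x = w x"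
  shows "L2_norm \<Omega> v = L2_norm \<Omega> w"
  unfolding L2_norm_def using L2_inner_AE[OF assms(1,2,2,3,3)] by simp

text \<open>
  The usual discriminant argument for the nonnegative quadratic \<open>t \<mapsto> \<parallel>v + t w\<parallel>\<^sup>2\<close>.
\<close>

lemma L2_Cauchy_Schwarz:
  assumes v: "v \<in> L2 \<Omega>" and w: "w \<in> L2 \<Omega>"
  shows "\<bar>L2_inner \<Omega> v w\<bar> \<le> L2_norm \<Omega> v * L2_norm \<Omega> w"
proof -
  let ?A = "L2_inner \<Omega> v v" and ?B = "L2_inner \<Omega> v w" and ?C = "L2_inner \<Omega> w w"
  have quadratic: "0 \<le> ?A + 2 * t * ?B + t\<^sup>2 * ?C" for t
  proof -
    have "L2_inner \<Omega> (\<lambda>x. v x + t *\<^sub>R w x) (\<lambda>x. v x + t *\<^sub>R w x)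
       = L2_inner \<Omega> v (\<lambda>x. v x + t *\<^sub>R w x) + t * L2_inner \<Omega> w (\<lambda>x. v x + t *\<^sub>R w x)"
      by (simp add: L2_inner_add_left L2_inner_scaleR_left L2_add L2_scaleR v w)
    also have "\<dots> = ?A + 2 * t * ?B + t\<^sup>2 * ?C"
      by (subst (1 2) L2_inner_commute)
        (simp add: L2_inner_add_left L2_inner_scaleR_left L2_scaleR v w L2_inner_commute[of \<Omega> w v]
          power2_eq_square algebra_simps)
    finally show ?thesis using L2_inner_self_nonneg by metis
  qed
  have "?B\<^sup>2 \<le> ?A * ?C"
  proof (cases "?C = 0")
    case True
    have "?B = 0"
    \<comment> \<open>otherwise the quadratic is affine in \<open>t\<close> and takes the value \<open>-1\<close>\<close>
    proof (rule ccontr)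
      assume "?B \<noteq> 0"
      then show False using quadratic[of "- (?A + 1) / (2 * ?B)"] True by (simp add: field_simps)
    qed
    then show ?thesis using True by simp
  next
    case False
    then have C: "?C > 0" using L2_inner_self_nonneg[of \<Omega> w] by simp
    have "0 \<le> ?C * (?A + 2 * (- ?B / ?C) * ?B + (- ?B / ?C)\<^sup>2 * ?C)"
      by (rule mult_nonneg_nonneg[OF less_imp_le[OF C] quadratic])
    also have "\<dots> = ?A * ?C - ?B\<^sup>2"
      using C by (simp add: power2_eq_square field_simps)
    finally show ?thesis by simp
  qed
  then have "sqrt (?B\<^sup>2) \<le> sqrt (?A * ?C)" by (rule real_sqrt_le_mono)
  then show ?thesis by (simp add: L2_norm_def real_sqrt_mult)
qed

lemma L2_norm_triangle:
  assumes v: "v \<in> L2 \<Omega>" and w: "w \<in> L2 \<Omega>"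
  shows "L2_norm \<Omega> (\<lambda>x. v x + w x) \<le> L2_norm \<Omega> v + L2_norm \<Omega> w"
proof (rule power2_le_imp_le)
  have "(L2_norm \<Omega> (\<lambda>x. v x + w x))\<^sup>2 = L2_inner \<Omega> v (\<lambda>x. v x + w x) + L2_inner \<Omega> w (\<lambda>x. v x + w x)"
    by (simp add: L2_norm_square L2_inner_add_left L2_add v w)
  also have "\<dots> = (L2_norm \<Omega> v)\<^sup>2 + 2 * L2_inner \<Omega> v w + (L2_norm \<Omega> w)\<^sup>2"
    by (subst (1 2) L2_inner_commute)
      (simp add: L2_norm_square L2_inner_add_left v w L2_inner_commute[of \<Omega> w v])
  also have "\<dots> \<le> (L2_norm \<Omega> v + L2_norm \<Omega> w)\<^sup>2"
    using L2_Cauchy_Schwarz[OF v w] by (simp add: power2_sum)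
  finally show "(L2_norm \<Omega> (\<lambda>x. v x + w x))\<^sup>2 \<le> (L2_norm \<Omega> v + L2_norm \<Omega> w)\<^sup>2" .
qed (simp add: L2_norm_nonneg)

lemma L2_norm_bounded_le:
  assumes v: "v \<in> L2 \<Omega>" and w: "w \<in> borel_measurable (lebesgue_on \<Omega>)" and C: "0 \<le> C"
    and le: "AE x in lebesgue_on \<Omega>. norm (w x) \<le> C * norm (v x)"
  shows "L2_norm \<Omega> w \<le> C * L2_norm \<Omega> v"
proof (rule power2_le_imp_le)
  note [measurable] = L2_measurable[OF v] w
  have le2: "AE x in lebesgue_on \<Omega>. (norm (w x))\<^sup>2 \<le> C\<^sup>2 * (norm (v x))\<^sup>2"
    using le by eventually_elim (metis norm_ge_zero power_mono power_mult_distrib)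
  have int: "integrable (lebesgue_on \<Omega>) (\<lambda>x. C\<^sup>2 * (norm (v x))\<^sup>2)"
    using v by (auto simp: L2_def)
  have "(LINT x|lebesgue_on \<Omega>. (norm (w x))\<^sup>2) \<le> (LINT x|lebesgue_on \<Omega>. C\<^sup>2 * (norm (v x))\<^sup>2)"
  proof (rule integral_mono_AE[OF _ int le2])
    show "integrable (lebesgue_on \<Omega>) (\<lambda>x. (norm (w x))\<^sup>2)"
      by (rule Bochner_Integration.integrable_bound[OF int]) (measurable, use le2 in \<open>eventually_elim, simp\<close>)
  qed
  then show "(L2_norm \<Omega> w)\<^sup>2 \<le> (C * L2_norm \<Omega> v)\<^sup>2"
    by (simp add: power_mult_distrib L2_norm_square L2_inner_self)
qed (simp add: L2_norm_nonneg C)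

text \<open>
  On a set of finite measure, \<open>|v| \<le> 1 + |v|\<^sup>2\<close> bounds \<open>v\<close> by an integrable function.
\<close>

lemma L2_locally_integrable:
  fixes v :: "'a::euclidean_space \<Rightarrow> 'b::euclidean_space"
  assumes \<Omega>: "\<Omega> \<in> sets lebesgue" and v: "v \<in> L2 \<Omega>"
  shows "locally_integrable \<Omega> v"
  unfolding locally_integrable_def
proof (intro allI impI)
  fix K assume K: "compact K \<and> K \<subseteq> \<Omega>"
  then have Ks: "K \<in> sets lebesgue" by (simp add: borel_compact)
  define w where "w = (\<lambda>x. if x \<in> \<Omega> then v x else 0)"
  have [measurable]: "w \<in> borel_measurable lebesgue"
    unfolding w_def by (rule borel_measurable_if_I[OF L2_measurable[OF v] \<Omega>])
  have "integrable (lebesgue_on \<Omega>) (\<lambda>x. (norm (v x))\<^sup>2)"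
    using v by (simp add: L2_def)
  then have "integrable lebesgue (\<lambda>x. if x \<in> \<Omega> then (norm (v x))\<^sup>2 else 0)"
    by (simp add: Lebesgue_Measure.integrable_restrict_UNIV[OF \<Omega>])
  moreover have "integrable lebesgue (indicator K :: 'a \<Rightarrow> real)"
  proof (rule integrable_real_indicator[OF Ks])
    show "emeasure lebesgue K < \<infinity>"
      using K emeasure_bounded_finite[of K] by (simp add: compact_imp_bounded borel_compact emeasure_completion)
  qed
  ultimately have "integrable lebesgue (\<lambda>x. indicator K x + (if x \<in> \<Omega> then (norm (v x))\<^sup>2 else 0))"
    by simp
  then have "integrable lebesgue (\<lambda>x. indicator K x *\<^sub>R w x)"
  proof (rule Bochner_Integration.integrable_bound)
    show "(\<lambda>x. indicator K x *\<^sub>R w x) \<in> borel_measurable lebesgue"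
      using Ks by measurable
    have "t \<le> 1 + t\<^sup>2" if "0 \<le> t" for t :: real
      using sum_squares_bound[of t 1] that by simp
    then show "AE x in lebesgue. norm (indicator K x *\<^sub>R w x)
        \<le> norm (indicator K x + (if x \<in> \<Omega> then (norm (v x))\<^sup>2 else 0))"
      using K by (intro AE_I2) (auto simp: indicator_def w_def)
  qed
  also have "(\<lambda>x. indicator K x *\<^sub>R w x) = (\<lambda>x. indicator K x *\<^sub>R v x)"
    using K by (auto simp: w_def indicator_def fun_eq_iff)
  finally show "set_integrable lebesgue K v" by (simp add: set_integrable_def)
qed

lemma continuous_compact_support_L2:
  fixes p :: "'a::euclidean_space \<Rightarrow> real"
  assumes \<Omega>: "\<Omega> \<in> sets lebesgue" and p: "continuous_on UNIV p" "compact K" "K \<subseteq> \<Omega>" "\<And>x. x \<notin> K \<Longrightarrow> p x = 0"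
  shows "p \<in> L2 \<Omega>"
proof -
  have "integrable lborel (\<lambda>x. (p x)\<^sup>2)"
    using p by (intro continuous_compact_support_integrable[where K = K] continuous_intros) auto
  then have "integrable lebesgue (\<lambda>x. (p x)\<^sup>2)"
    by (simp add: integrable_completion)
  then have "integrable (lebesgue_on \<Omega>) (\<lambda>x. (p x)\<^sup>2)"
    using p by (subst integral_lebesgue_on_vanishing(2)[OF \<Omega>]) auto
  moreover have "p \<in> borel_measurable (lebesgue_on \<Omega>)"
    using p by (intro borel_measurable_lebesgue_onI borel_measurable_continuous_onI)
  ultimately show ?thesis by (simp add: L2_def)
qed

lemma test_function_L2:
  assumes \<Omega>: "\<Omega> \<in> sets lebesgue" and \<phi>: "\<phi> \<in> test_functions \<Omega>"
  shows "\<phi> \<in> L2 \<Omega>" "b \<in> Basis \<Longrightarrow> partial \<phi> b \<in> L2 \<Omega>" "gradient \<phi> \<in> L2 \<Omega>"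
proof -
  obtain K where K: "compact K" "K \<subseteq> \<Omega>" "\<And>x. x \<notin> K \<Longrightarrow> \<phi> x = 0"
    "\<And>x b. x \<notin> K \<Longrightarrow> partial \<phi> b x = 0" "\<And>x. x \<notin> K \<Longrightarrow> gradient \<phi> x = 0"
    using test_function_support[OF \<phi>] by blast
  note s = test_function_smooth[OF \<phi>]
  show "\<phi> \<in> L2 \<Omega>"
    by (rule continuous_compact_support_L2[OF \<Omega> smooth_continuous[OF s] K(1,2,3)])
  show "partial \<phi> b \<in> L2 \<Omega>" if "b \<in> Basis"
    by (rule continuous_compact_support_L2[OF \<Omega> smooth_partial_continuous[OF s that] K(1,2,4)])
  have n: "(\<lambda>x. norm (gradient \<phi> x)) \<in> L2 \<Omega>"
    using K by (intro continuous_compact_support_L2[OF \<Omega> _ K(1,2)] continuous_on_norm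
        smooth_gradient_continuous s) auto
  have "gradient \<phi> \<in> borel_measurable (lebesgue_on \<Omega>)"
    using smooth_borel_measurable(3)[OF s] by (rule borel_measurable_lebesgue_onI)
  with n show "gradient \<phi> \<in> L2 \<Omega>" by (simp add: L2_def)
qed

section \<open>Weak gradients\<close>

lemma locally_integrable_diff:
  "locally_integrable \<Omega> v \<Longrightarrow> locally_integrable \<Omega> w \<Longrightarrow> locally_integrable \<Omega> (\<lambda>x. v x - w x)"
  by (auto simp: locally_integrable_def)

lemma locally_integrable_inner:
  "locally_integrable \<Omega> g \<Longrightarrow> locally_integrable \<Omega> (\<lambda>x. g x \<bullet> b)"
  using integrable_inner_left by (fastforce simp: locally_integrable_def set_integrable_def)

lemma test_function_integrable:
  fixes v :: "'a::euclidean_space \<Rightarrow> real"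
  assumes \<Omega>: "\<Omega> \<in> sets lebesgue" and v: "locally_integrable \<Omega> v" and \<phi>: "\<phi> \<in> test_functions \<Omega>"
  shows "integrable (lebesgue_on \<Omega>) (\<lambda>x. v x * \<phi> x)"
    and "b \<in> Basis \<Longrightarrow> integrable (lebesgue_on \<Omega>) (\<lambda>x. v x * partial \<phi> b x)"
proof -
  obtain K where K: "compact K" "K \<subseteq> \<Omega>" "\<And>x. x \<notin> K \<Longrightarrow> \<phi> x = 0"
    "\<And>x b. x \<notin> K \<Longrightarrow> partial \<phi> b x = 0"
    using test_function_support[OF \<phi>] by metis
  note s = test_function_smooth[OF \<phi>]
  show "integrable (lebesgue_on \<Omega>) (\<lambda>x. v x * \<phi> x)"
    using locally_integrable_times_continuous[OF \<Omega> v smooth_continuous[OF s] K(1,2,3)]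
    by (simp add: mult.commute)
  show "integrable (lebesgue_on \<Omega>) (\<lambda>x. v x * partial \<phi> b x)" if "b \<in> Basis"
    using locally_integrable_times_continuous[OF \<Omega> v smooth_partial_continuous[OF s that] K(1,2,4)]
    by (simp add: mult.commute)
qed

text \<open>
  Each component of \<open>g - h\<close> integrates to zero against every test function.
\<close>

lemma has_weak_gradient_AE_unique:
  assumes \<Omega>: "open \<Omega>" and g: "has_weak_gradient \<Omega> v g" and h: "has_weak_gradient \<Omega> w h"
    and eq: "AE x in lebesgue_on \<Omega>. v x = w x"
  shows "AE x in lebesgue_on \<Omega>. g x = h x"
proof -
  have \<Omega>': "\<Omega> \<in> sets lebesgue" using \<Omega> by simp
  have "AE x in lebesgue_on \<Omega>. (g x - h x) \<bullet> b = 0" if b: "b \<in> Basis" for b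
  proof (rule fundamental_lemma[OF \<Omega>])
    have lg: "locally_integrable \<Omega> (\<lambda>x. g x \<bullet> b)" and lh: "locally_integrable \<Omega> (\<lambda>x. h x \<bullet> b)"
      using g h by (auto simp: has_weak_gradient_def intro: locally_integrable_inner)
    then show "locally_integrable \<Omega> (\<lambda>x. (g x - h x) \<bullet> b)"
      unfolding inner_diff_left by (rule locally_integrable_diff)
    fix \<phi> assume \<phi>: "\<phi> \<in> test_functions \<Omega>"
    have "AE x in lebesgue_on \<Omega>. v x * partial \<phi> b x = w x * partial \<phi> b x"
      using eq by eventually_elim simp
    then have "(LINT x|lebesgue_on \<Omega>. v x * partial \<phi> b x) = (LINT x|lebesgue_on \<Omega>. w x * partial \<phi> b x)"
      using g b \<phi> by (intro integral_lebesgue_on_AE[OF \<Omega>'] test_function_integrable \<Omega>')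
        (auto simp: has_weak_gradient_def)
    then have "(LINT x|lebesgue_on \<Omega>. (g x \<bullet> b) * \<phi> x) = (LINT x|lebesgue_on \<Omega>. (h x \<bullet> b) * \<phi> x)"
      using g h b \<phi> by (simp add: has_weak_gradient_def)
    then show "(LINT x|lebesgue_on \<Omega>. (g x - h x) \<bullet> b * \<phi> x) = 0"
      using test_function_integrable(1)[OF \<Omega>' lg \<phi>] test_function_integrable(1)[OF \<Omega>' lh \<phi>]
      by (simp add: inner_diff_left left_diff_distrib)
  qed
  then have "AE x in lebesgue_on \<Omega>. \<forall>b\<in>Basis. (g x - h x) \<bullet> b = 0"
    by (intro AE_ball_countable[THEN iffD2]) (auto simp: countable_finite)
  then show ?thesis
    by eventually_elim (simp add: euclidean_eq_iff[of "g _"] inner_diff_left)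
qed

lemma weak_gradient_AE_eq:
  assumes "open \<Omega>" "has_weak_gradient \<Omega> v g"
  shows "AE x in lebesgue_on \<Omega>. weak_gradient \<Omega> v x = g x"
proof (rule has_weak_gradient_AE_unique[OF assms(1) _ assms(2)])
  show "has_weak_gradient \<Omega> v (weak_gradient \<Omega> v)"
    unfolding weak_gradient_def by (rule someI[of "has_weak_gradient \<Omega> v", OF assms(2)])
qed simp

lemma has_weak_gradient_diff:
  assumes \<Omega>: "\<Omega> \<in> sets lebesgue" and g: "has_weak_gradient \<Omega> v g" and h: "has_weak_gradient \<Omega> w h"
  shows "has_weak_gradient \<Omega> (\<lambda>x. v x - w x) (\<lambda>x. g x - h x)"
  unfolding has_weak_gradient_def
proof (intro conjI ballI)
  have lv: "locally_integrable \<Omega> v" and lw: "locally_integrable \<Omega> w"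
    and lg: "locally_integrable \<Omega> g" and lh: "locally_integrable \<Omega> h"
    using g h by (auto simp: has_weak_gradient_def)
  show "locally_integrable \<Omega> (\<lambda>x. v x - w x)" "locally_integrable \<Omega> (\<lambda>x. g x - h x)"
    by (intro locally_integrable_diff lv lw lg lh)+
  fix \<phi> b assume \<phi>: "\<phi> \<in> test_functions \<Omega>" and b: "b \<in> (Basis :: 'a set)"
  note int = test_function_integrable(2)[OF \<Omega> lv \<phi> b] test_function_integrable(2)[OF \<Omega> lw \<phi> b]
    test_function_integrable(1)[OF \<Omega> locally_integrable_inner[OF lg, of b] \<phi>]
    test_function_integrable(1)[OF \<Omega> locally_integrable_inner[OF lh, of b] \<phi>]
  show "(LINT x|lebesgue_on \<Omega>. (v x - w x) * partial \<phi> b x)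
      = - (LINT x|lebesgue_on \<Omega>. (g x - h x) \<bullet> b * \<phi> x)"
    using g h \<phi> b int by (simp add: has_weak_gradient_def left_diff_distrib inner_diff_left)
qed

lemma continuous_locally_integrable:
  fixes v :: "'a::euclidean_space \<Rightarrow> 'b::euclidean_space"
  assumes "continuous_on UNIV v"
  shows "locally_integrable \<Omega> v"
  unfolding locally_integrable_def set_integrable_def
proof (intro allI impI)
  fix K :: "'a set" assume "compact K \<and> K \<subseteq> \<Omega>"
  then have "integrable lborel (\<lambda>x. indicator K x *\<^sub>R v x)"
    by (intro borel_integrable_compact continuous_on_subset[OF assms]) auto
  then show "integrable lebesgue (\<lambda>x. indicator K x *\<^sub>R v x)"
    using integrable_completion borel_measurable_integrable by blast
qed

lemma smooth_has_weak_gradient: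
  assumes \<Omega>: "\<Omega> \<in> sets lebesgue" and f: "\<forall>k. C_k k f"
  shows "has_weak_gradient \<Omega> f (gradient f)"
  unfolding has_weak_gradient_def
proof (intro conjI ballI)
  show "locally_integrable \<Omega> f" "locally_integrable \<Omega> (gradient f)"
    by (intro continuous_locally_integrable smooth_continuous smooth_gradient_continuous f)+
  fix \<phi> b assume \<phi>: "\<phi> \<in> test_functions \<Omega>" and b: "b \<in> (Basis :: 'a set)"
  obtain K where K: "K \<subseteq> \<Omega>" "\<And>x. x \<notin> K \<Longrightarrow> \<phi> x = 0" "\<And>x b. x \<notin> K \<Longrightarrow> partial \<phi> b x = 0"
    using test_function_support[OF \<phi>] by metis
  note [measurable] = smooth_borel_measurable(1)[OF f] smooth_borel_measurable(2)[OF f b]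
    smooth_borel_measurable(1)[OF test_function_smooth[OF \<phi>]]
    smooth_borel_measurable(2)[OF test_function_smooth[OF \<phi>] b]
  have "(LINT x|lebesgue_on \<Omega>. f x * partial \<phi> b x) = (LINT x|lborel. f x * partial \<phi> b x)"
    by (subst integral_lebesgue_on_vanishing(1)[OF \<Omega>]) (use K in \<open>auto simp: integral_completion\<close>)
  also have "\<dots> = - (LINT x|lborel. partial f b x * \<phi> x)"
    by (rule test_function_integration_by_parts[OF f \<phi> b])
  also have "(LINT x|lborel. partial f b x * \<phi> x) = (LINT x|lebesgue_on \<Omega>. partial f b x * \<phi> x)"
    by (subst integral_lebesgue_on_vanishing(1)[OF \<Omega>]) (use K in \<open>auto simp: integral_completion\<close>)
  finally show "(LINT x|lebesgue_on \<Omega>. f x * partial \<phi> b x) = - (LINT x|lebesgue_on \<Omega>. gradient f x \<bullet> b * \<phi> x)"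
    by (simp add: gradient_inner_Basis b)
qed

subsection \<open>Limits of test functions in the Sobolev norm\<close>

text \<open>
  The closure in \<open>L\<^sup>2 \<times> L\<^sup>2\<close> of the graph of the gradient on test functions. Its members are the
  pairs of an element of \<open>H\<^sup>1\<^sub>0\<close> and its weak gradient, without reference to a choice of the latter.
\<close>

definition H10_pair :: "'a::euclidean_space set \<Rightarrow> ('a \<Rightarrow> real) \<Rightarrow> ('a \<Rightarrow> 'a) \<Rightarrow> bool" where
  "H10_pair \<Omega> v g \<longleftrightarrow> v \<in> L2 \<Omega> \<and> g \<in> L2 \<Omega> \<and> (\<forall>\<epsilon>>0. \<exists>\<phi>\<in>test_functions \<Omega>.
     L2_norm \<Omega> (\<lambda>x. v x - \<phi> x) < \<epsilon> \<and> L2_norm \<Omega> (\<lambda>x. g x - gradient \<phi> x) < \<epsilon>)"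

lemma H10_pair_L2: "H10_pair \<Omega> v g \<Longrightarrow> v \<in> L2 \<Omega>" "H10_pair \<Omega> v g \<Longrightarrow> g \<in> L2 \<Omega>"
  by (auto simp: H10_pair_def)

lemma H10_pair_approx:
  assumes "H10_pair \<Omega> v g" "\<epsilon> > 0"
  obtains \<phi> where "\<phi> \<in> test_functions \<Omega>" "L2_norm \<Omega> (\<lambda>x. v x - \<phi> x) < \<epsilon>"
    "L2_norm \<Omega> (\<lambda>x. g x - gradient \<phi> x) < \<epsilon>"
  using assms by (auto simp: H10_pair_def)

lemma L2_norm_zero: "L2_norm \<Omega> (\<lambda>x. 0) = 0"
  by (simp add: L2_norm_def L2_inner_def)

lemma test_function_H10_pair:
  assumes "\<Omega> \<in> sets lebesgue" "\<phi> \<in> test_functions \<Omega>"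
  shows "H10_pair \<Omega> \<phi> (gradient \<phi>)"
  using assms test_function_L2 by (auto simp: H10_pair_def L2_norm_zero intro!: bexI[of _ \<phi>])

lemma H10_pair_AE:
  assumes \<Omega>: "\<Omega> \<in> sets lebesgue" and vg: "H10_pair \<Omega> v g"
    and eq: "AE x in lebesgue_on \<Omega>. v x = w x" "AE x in lebesgue_on \<Omega>. g x = h x"
  shows "H10_pair \<Omega> w h"
  unfolding H10_pair_def
proof (intro conjI allI impI)
  show "w \<in> L2 \<Omega>" "h \<in> L2 \<Omega>"
    using L2_AE[OF \<Omega>] H10_pair_L2[OF vg] eq by blast+
  fix \<epsilon> :: real assume "\<epsilon> > 0"
  with vg obtain \<phi> where \<phi>: "\<phi> \<in> test_functions \<Omega>" "L2_norm \<Omega> (\<lambda>x. v x - \<phi> x) < \<epsilon>"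
    "L2_norm \<Omega> (\<lambda>x. g x - gradient \<phi> x) < \<epsilon>"
    by (rule H10_pair_approx)
  have "L2_norm \<Omega> (\<lambda>x. v x - \<phi> x) = L2_norm \<Omega> (\<lambda>x. w x - \<phi> x)"
    by (rule L2_norm_AE[OF \<Omega> L2_diff[OF H10_pair_L2(1)[OF vg] test_function_L2(1)[OF \<Omega> \<phi>(1)]]])
      (use eq in auto)
  moreover have "L2_norm \<Omega> (\<lambda>x. g x - gradient \<phi> x) = L2_norm \<Omega> (\<lambda>x. h x - gradient \<phi> x)"
    by (rule L2_norm_AE[OF \<Omega> L2_diff[OF H10_pair_L2(2)[OF vg] test_function_L2(3)[OF \<Omega> \<phi>(1)]]])
      (use eq in auto)
  ultimately show "\<exists>\<phi>\<in>test_functions \<Omega>. L2_norm \<Omega> (\<lambda>x. w x - \<phi> x) < \<epsilon> \<and> L2_norm \<Omega> (\<lambda>x. h x - gradient \<phi> x) < \<epsilon>"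
    using \<phi> by auto
qed

lemma H10_pair_add:
  assumes \<Omega>: "\<Omega> \<in> sets lebesgue" and vg: "H10_pair \<Omega> v g" and wh: "H10_pair \<Omega> w h"
  shows "H10_pair \<Omega> (\<lambda>x. v x + w x) (\<lambda>x. g x + h x)"
  unfolding H10_pair_def
proof (intro conjI allI impI)
  note L2 = H10_pair_L2[OF vg] H10_pair_L2[OF wh]
  show "(\<lambda>x. v x + w x) \<in> L2 \<Omega>" "(\<lambda>x. g x + h x) \<in> L2 \<Omega>"
    by (intro L2_add L2)+
  fix \<epsilon> :: real assume "\<epsilon> > 0"
  then have e: "\<epsilon> / 2 > 0" by simp
  obtain \<phi> where \<phi>: "\<phi> \<in> test_functions \<Omega>" "L2_norm \<Omega> (\<lambda>x. v x - \<phi> x) < \<epsilon> / 2"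
    "L2_norm \<Omega> (\<lambda>x. g x - gradient \<phi> x) < \<epsilon> / 2"
    by (rule H10_pair_approx[OF vg e])
  obtain \<psi> where \<psi>: "\<psi> \<in> test_functions \<Omega>" "L2_norm \<Omega> (\<lambda>x. w x - \<psi> x) < \<epsilon> / 2"
    "L2_norm \<Omega> (\<lambda>x. h x - gradient \<psi> x) < \<epsilon> / 2"
    by (rule H10_pair_approx[OF wh e])
  note T = test_function_L2[OF \<Omega> \<phi>(1)] test_function_L2[OF \<Omega> \<psi>(1)]
  have "L2_norm \<Omega> (\<lambda>x. (v x - \<phi> x) + (w x - \<psi> x)) < \<epsilon>"
    using L2_norm_triangle[OF L2_diff[OF L2(1) T(1)] L2_diff[OF L2(3) T(4)]] \<phi> \<psi> by simp
  moreover have "L2_norm \<Omega> (\<lambda>x. (g x - gradient \<phi> x) + (h x - gradient \<psi> x)) < \<epsilon>"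
    using L2_norm_triangle[OF L2_diff[OF L2(2) T(3)] L2_diff[OF L2(4) T(6)]] \<phi> \<psi> by simp
  ultimately show "\<exists>\<phi>\<in>test_functions \<Omega>. L2_norm \<Omega> (\<lambda>x. v x + w x - \<phi> x) < \<epsilon>
      \<and> L2_norm \<Omega> (\<lambda>x. g x + h x - gradient \<phi> x) < \<epsilon>"
    using test_functions_add[OF \<phi>(1) \<psi>(1)]
      gradient_add[OF test_function_smooth[OF \<phi>(1)] test_function_smooth[OF \<psi>(1)]]
    by (intro bexI[of _ "\<lambda>x. \<phi> x + \<psi> x"]) (simp_all add: algebra_simps)
qed

lemma H10_pair_scale:
  assumes vg: "H10_pair \<Omega> v g"
  shows "H10_pair \<Omega> (\<lambda>x. c * v x) (\<lambda>x. c *\<^sub>R g x)"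
  unfolding H10_pair_def
proof (intro conjI allI impI)
  show "(\<lambda>x. c * v x) \<in> L2 \<Omega>" "(\<lambda>x. c *\<^sub>R g x) \<in> L2 \<Omega>"
    by (intro L2_cmult L2_scaleR H10_pair_L2[OF vg])+
  fix \<epsilon> :: real assume "\<epsilon> > 0"
  then have e: "\<epsilon> / (\<bar>c\<bar> + 1) > 0" by simp
  obtain \<phi> where \<phi>: "\<phi> \<in> test_functions \<Omega>" "L2_norm \<Omega> (\<lambda>x. v x - \<phi> x) < \<epsilon> / (\<bar>c\<bar> + 1)"
    "L2_norm \<Omega> (\<lambda>x. g x - gradient \<phi> x) < \<epsilon> / (\<bar>c\<bar> + 1)"
    by (rule H10_pair_approx[OF vg e])
  have small: "\<bar>c\<bar> * t < \<epsilon>" if "t < \<epsilon> / (\<bar>c\<bar> + 1)" "0 \<le> t" for t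
  proof -
    have "\<bar>c\<bar> * t \<le> (\<bar>c\<bar> + 1) * t" using that by (intro mult_right_mono) auto
    also have "\<dots> < \<epsilon>" using that by (simp add: field_simps)
    finally show ?thesis .
  qed
  have "L2_norm \<Omega> (\<lambda>x. c *\<^sub>R (v x - \<phi> x)) < \<epsilon>" "L2_norm \<Omega> (\<lambda>x. c *\<^sub>R (g x - gradient \<phi> x)) < \<epsilon>"
    using small \<phi> L2_norm_nonneg unfolding L2_norm_scaleR by blast+
  then show "\<exists>\<phi>\<in>test_functions \<Omega>. L2_norm \<Omega> (\<lambda>x. c * v x - \<phi> x) < \<epsilon>
      \<and> L2_norm \<Omega> (\<lambda>x. c *\<^sub>R g x - gradient \<phi> x) < \<epsilon>"
    using test_functions_smooth_mult[OF allI[OF C_k_const] \<phi>(1), of c]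
      gradient_cmult[OF test_function_smooth[OF \<phi>(1)], of c]
    by (intro bexI[of _ "\<lambda>x. c * \<phi> x"]) (simp_all add: algebra_simps)
qed

text \<open>
  Against a fixed test function \<open>\<psi>\<close>, the defining identity of the weak gradient of \<open>\<rho> v\<close> says that a
  certain \<open>L\<^sup>2\<close>-continuous functional of \<open>(v, g)\<close> vanishes. On the graph of the gradient over test
  functions \<open>\<phi>\<close> it does so because \<open>\<phi> \<psi>\<close> is an admissible test function for \<open>\<rho>\<close>.
\<close>

lemma H10_pair_product_rule:
  fixes \<rho> :: "'a::euclidean_space \<Rightarrow> real"
  assumes \<Omega>: "\<Omega> \<in> sets lebesgue" and vg: "H10_pair \<Omega> v g"
    and \<rho>: "\<rho> \<in> Linf \<Omega>" and r: "r \<in> Linf \<Omega>" and \<rho>r: "has_weak_gradient \<Omega> \<rho> r"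
  shows "has_weak_gradient \<Omega> (\<lambda>x. \<rho> x * v x) (\<lambda>x. \<rho> x *\<^sub>R g x + v x *\<^sub>R r x)"
  unfolding has_weak_gradient_def
proof (intro conjI ballI)
  note L2 = H10_pair_L2[OF vg]
  have \<rho>v: "(\<lambda>x. \<rho> x * v x) \<in> L2 \<Omega>"
    using L2_bounded_scaleR[OF \<rho> L2(1)] by simp
  have gr: "(\<lambda>x. \<rho> x *\<^sub>R g x + v x *\<^sub>R r x) \<in> L2 \<Omega>"
    by (intro L2_add L2_bounded_scaleR L2_bounded_swap \<rho> r L2)
  show "locally_integrable \<Omega> (\<lambda>x. \<rho> x * v x)" "locally_integrable \<Omega> (\<lambda>x. \<rho> x *\<^sub>R g x + v x *\<^sub>R r x)"
    by (intro L2_locally_integrable \<Omega> \<rho>v gr)+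
  fix \<psi> b assume \<psi>: "\<psi> \<in> test_functions \<Omega>" and b: "b \<in> (Basis :: 'a set)"
  note T\<psi> = test_function_L2[OF \<Omega> \<psi>]
  define P where "P = (\<lambda>x. \<rho> x * partial \<psi> b x + (r x \<bullet> b) * \<psi> x)"
  define Q where "Q = (\<lambda>x. (\<rho> x * \<psi> x) *\<^sub>R b)"
  have rb: "(\<lambda>x. r x \<bullet> b) \<in> Linf \<Omega>"
  proof -
    from r obtain C where [measurable]: "r \<in> borel_measurable (lebesgue_on \<Omega>)"
      and C: "AE x in lebesgue_on \<Omega>. norm (r x) \<le> C"
      by (auto simp: Linf_def)
    have "AE x in lebesgue_on \<Omega>. norm (r x \<bullet> b) \<le> C"
      using C by eventually_elim (metis Basis_le_norm[OF b] order_trans real_norm_def)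
    moreover have "(\<lambda>x. r x \<bullet> b) \<in> borel_measurable (lebesgue_on \<Omega>)" by measurable
    ultimately show ?thesis by (auto simp: Linf_def)
  qed
  have P: "P \<in> L2 \<Omega>"
    unfolding P_def using L2_bounded_scaleR[OF \<rho> T\<psi>(2)[OF b]] L2_bounded_scaleR[OF rb T\<psi>(1)]
    by (intro L2_add) simp_all
  have \<rho>\<psi>: "(\<lambda>x. \<rho> x * \<psi> x) \<in> L2 \<Omega>"
    using L2_bounded_scaleR[OF \<rho> T\<psi>(1)] by simp
  have bc: "(\<lambda>_. b) \<in> Linf \<Omega>" by (auto simp: Linf_def)
  have Q: "Q \<in> L2 \<Omega>"
    unfolding Q_def by (rule L2_bounded_swap[OF bc \<rho>\<psi>])
  have graph: "L2_inner \<Omega> \<phi> P + L2_inner \<Omega> (gradient \<phi>) Q = 0" if \<phi>: "\<phi> \<in> test_functions \<Omega>" for \<phi>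
  proof -
    note T\<phi> = test_function_L2[OF \<Omega> \<phi>]
    note s = test_function_smooth[OF \<phi>] test_function_smooth[OF \<psi>]
    have p: "partial (\<lambda>x. \<phi> x * \<psi> x) b x = \<phi> x * partial \<psi> b x + partial \<phi> b x * \<psi> x" for x
      by (intro partial_mult smooth_differentiable s)
    have "(LINT x|lebesgue_on \<Omega>. \<rho> x * partial (\<lambda>x. \<phi> x * \<psi> x) b x)
        = - (LINT x|lebesgue_on \<Omega>. (r x \<bullet> b) * (\<phi> x * \<psi> x))"
      using \<rho>r b test_functions_smooth_mult[OF s(1) \<psi>] by (auto simp: has_weak_gradient_def)
    moreover have "L2_inner \<Omega> \<phi> P + L2_inner \<Omega> (gradient \<phi>) Q
        = (LINT x|lebesgue_on \<Omega>. \<phi> x \<bullet> P x + gradient \<phi> x \<bullet> Q x)"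
      unfolding L2_inner_def by (intro Bochner_Integration.integral_add[symmetric] L2_inner_integrable T\<phi> P Q)
    moreover have "\<phi> x \<bullet> P x + gradient \<phi> x \<bullet> Q x
        = \<rho> x * partial (\<lambda>x. \<phi> x * \<psi> x) b x + (r x \<bullet> b) * (\<phi> x * \<psi> x)" for x
      by (simp add: P_def Q_def p gradient_inner_Basis[OF b] algebra_simps)
    moreover have "integrable (lebesgue_on \<Omega>) (\<lambda>x. \<rho> x * partial (\<lambda>x. \<phi> x * \<psi> x) b x)"
      using \<rho>r by (intro test_function_integrable \<Omega> b test_functions_smooth_mult[OF s(1) \<psi>])
        (simp add: has_weak_gradient_def)
    moreover have "integrable (lebesgue_on \<Omega>) (\<lambda>x. (r x \<bullet> b) * (\<phi> x * \<psi> x))"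
      using \<rho>r by (intro test_function_integrable \<Omega> test_functions_smooth_mult[OF s(1) \<psi>] locally_integrable_inner)
        (simp add: has_weak_gradient_def)
    ultimately show ?thesis by simp
  qed
  let ?T = "L2_inner \<Omega> v P + L2_inner \<Omega> g Q"
  have "\<bar>?T\<bar> \<le> 0"
  proof (rule field_le_epsilon)
    fix e :: real assume "e > 0"
    define C where "C = L2_norm \<Omega> P + L2_norm \<Omega> Q + 1"
    have C: "C > 0" using L2_norm_nonneg[of \<Omega> P] L2_norm_nonneg[of \<Omega> Q] by (simp add: C_def)
    obtain \<phi> where \<phi>: "\<phi> \<in> test_functions \<Omega>" "L2_norm \<Omega> (\<lambda>x. v x - \<phi> x) < e / C"
      "L2_norm \<Omega> (\<lambda>x. g x - gradient \<phi> x) < e / C"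
      using H10_pair_approx[OF vg, of "e / C"] \<open>e > 0\<close> C by auto
    note T\<phi> = test_function_L2[OF \<Omega> \<phi>(1)]
    have "?T = L2_inner \<Omega> (\<lambda>x. v x - \<phi> x) P + L2_inner \<Omega> (\<lambda>x. g x - gradient \<phi> x) Q"
      using graph[OF \<phi>(1)] by (simp add: L2_inner_diff_left L2 T\<phi> P Q)
    also have "\<bar>\<dots>\<bar> \<le> L2_norm \<Omega> (\<lambda>x. v x - \<phi> x) * L2_norm \<Omega> P + L2_norm \<Omega> (\<lambda>x. g x - gradient \<phi> x) * L2_norm \<Omega> Q"
      using L2_Cauchy_Schwarz[OF L2_diff[OF L2(1) T\<phi>(1)] P] L2_Cauchy_Schwarz[OF L2_diff[OF L2(2) T\<phi>(3)] Q]
      by linarith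
    also have "\<dots> \<le> e / C * L2_norm \<Omega> P + e / C * L2_norm \<Omega> Q"
      using \<phi> by (intro add_mono mult_right_mono L2_norm_nonneg) auto
    also have "\<dots> = e / C * (C - 1)" by (simp add: C_def distrib_left)
    also have "\<dots> \<le> e" using C \<open>e > 0\<close> by (simp add: field_simps)
    finally show "\<bar>?T\<bar> \<le> 0 + e" by simp
  qed
  then have "?T = 0" by simp
  moreover have "?T = (LINT x|lebesgue_on \<Omega>. v x \<bullet> P x + g x \<bullet> Q x)"
    unfolding L2_inner_def by (intro Bochner_Integration.integral_add[symmetric] L2_inner_integrable L2 P Q)
  moreover have "v x \<bullet> P x + g x \<bullet> Q x
      = \<rho> x * v x * partial \<psi> b x + ((\<rho> x *\<^sub>R g x + v x *\<^sub>R r x) \<bullet> b) * \<psi> x" for x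
    by (simp add: P_def Q_def algebra_simps)
  moreover have "integrable (lebesgue_on \<Omega>) (\<lambda>x. \<rho> x * v x * partial \<psi> b x)"
    by (intro test_function_integrable \<Omega> L2_locally_integrable \<rho>v \<psi> b)
  moreover have "integrable (lebesgue_on \<Omega>) (\<lambda>x. ((\<rho> x *\<^sub>R g x + v x *\<^sub>R r x) \<bullet> b) * \<psi> x)"
    by (intro test_function_integrable \<Omega> locally_integrable_inner L2_locally_integrable gr \<psi>)
  ultimately show "(LINT x|lebesgue_on \<Omega>. \<rho> x * v x * partial \<psi> b x)
      = - (LINT x|lebesgue_on \<Omega>. (\<rho> x *\<^sub>R g x + v x *\<^sub>R r x) \<bullet> b * \<psi> x)"
    by simp
qed

text \<open>
  The product rule for the constant factor \<open>1\<close>.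
\<close>

lemma H10_pair_has_weak_gradient:
  assumes \<Omega>: "\<Omega> \<in> sets lebesgue" and vg: "H10_pair \<Omega> v g"
  shows "has_weak_gradient \<Omega> v g"
proof -
  have "gradient (\<lambda>_. 1) = (\<lambda>_::'a. 0)" by (simp add: gradient_def fun_eq_iff)
  then have "has_weak_gradient \<Omega> (\<lambda>_. 1) (\<lambda>_. 0)"
    using smooth_has_weak_gradient[OF \<Omega>, of "\<lambda>_. 1"] by (simp add: C_k_const)
  then show ?thesis
    using H10_pair_product_rule[OF \<Omega> vg, of "\<lambda>_. 1" "\<lambda>_. 0"] by (auto simp: Linf_def)
qed

lemma H10_pair_weak_gradient:
  assumes "open \<Omega>" "H10_pair \<Omega> v g"
  shows "AE x in lebesgue_on \<Omega>. weak_gradient \<Omega> v x = g x"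
  using assms by (intro weak_gradient_AE_eq H10_pair_has_weak_gradient) auto

lemma H1_norm_eq:
  assumes \<Omega>: "open \<Omega>" and g: "has_weak_gradient \<Omega> v g" "g \<in> L2 \<Omega>"
  shows "H1_norm \<Omega> v = sqrt ((L2_norm \<Omega> v)\<^sup>2 + (L2_norm \<Omega> g)\<^sup>2)"
proof -
  have "AE x in lebesgue_on \<Omega>. g x = weak_gradient \<Omega> v x"
    using weak_gradient_AE_eq[OF \<Omega> g(1)] by eventually_elim simp
  from L2_norm_AE[OF _ g(2) this] have "L2_norm \<Omega> g = L2_norm \<Omega> (weak_gradient \<Omega> v)"
    using \<Omega> by simp
  then show ?thesis
    by (simp add: H1_norm_def L2_norm_square L2_inner_self)
qed

text \<open>
  The norm in the definition of \<open>H\<^sup>1\<^sub>0\<close> uses some weak gradient of \<open>v - \<phi>\<close>; by uniqueness it may be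
  computed with \<open>g - \<nabla>\<phi>\<close> instead, and then both definitions describe the same limits.
\<close>

lemma H10_iff_H10_pair:
  assumes \<Omega>: "open \<Omega>"
  shows "v \<in> H10 \<Omega> \<longleftrightarrow> (\<exists>g. H10_pair \<Omega> v g)"
proof -
  have \<Omega>': "\<Omega> \<in> sets lebesgue" using \<Omega> by simp
  have norm_eq: "H1_norm \<Omega> (\<lambda>x. v x - \<phi> x)
      = sqrt ((L2_norm \<Omega> (\<lambda>x. v x - \<phi> x))\<^sup>2 + (L2_norm \<Omega> (\<lambda>x. g x - gradient \<phi> x))\<^sup>2)"
    if "has_weak_gradient \<Omega> v g" "g \<in> L2 \<Omega>" "\<phi> \<in> test_functions \<Omega>" for g \<phi>
    using that by (intro H1_norm_eq \<Omega> has_weak_gradient_diff \<Omega>' smooth_has_weak_gradient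
        test_function_smooth L2_diff test_function_L2) auto
  show ?thesis
  proof
    assume v: "v \<in> H10 \<Omega>"
    then obtain g where g: "g \<in> L2 \<Omega>" "has_weak_gradient \<Omega> v g" and vL2: "v \<in> L2 \<Omega>"
      by (auto simp: H10_def H1_def)
    have "H10_pair \<Omega> v g"
      unfolding H10_pair_def
    proof (intro conjI allI impI g vL2)
      fix \<epsilon> :: real assume "\<epsilon> > 0"
      then obtain \<phi> where \<phi>: "\<phi> \<in> test_functions \<Omega>" "H1_norm \<Omega> (\<lambda>x. v x - \<phi> x) < \<epsilon>"
        using v by (auto simp: H10_def)
      then have "sqrt ((L2_norm \<Omega> (\<lambda>x. v x - \<phi> x))\<^sup>2 + (L2_norm \<Omega> (\<lambda>x. g x - gradient \<phi> x))\<^sup>2) < \<epsilon>"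
        using norm_eq[OF g(2,1)] by simp
      then show "\<exists>\<phi>\<in>test_functions \<Omega>. L2_norm \<Omega> (\<lambda>x. v x - \<phi> x) < \<epsilon> \<and> L2_norm \<Omega> (\<lambda>x. g x - gradient \<phi> x) < \<epsilon>"
        using \<phi>(1) by (meson le_less_trans real_sqrt_sum_squares_ge1 real_sqrt_sum_squares_ge2)
    qed
    then show "\<exists>g. H10_pair \<Omega> v g" by blast
  next
    assume "\<exists>g. H10_pair \<Omega> v g"
    then obtain g where vg: "H10_pair \<Omega> v g" by blast
    note g = H10_pair_has_weak_gradient[OF \<Omega>' vg] H10_pair_L2(2)[OF vg]
    show "v \<in> H10 \<Omega>"
      unfolding H10_def mem_Collect_eq
    proof (intro conjI allI impI)
      show "v \<in> H1 \<Omega>"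
        using g H10_pair_L2(1)[OF vg] by (auto simp: H1_def)
      fix \<epsilon> :: real assume "\<epsilon> > 0"
      then obtain \<phi> where \<phi>: "\<phi> \<in> test_functions \<Omega>" "L2_norm \<Omega> (\<lambda>x. v x - \<phi> x) < \<epsilon> / 2"
        "L2_norm \<Omega> (\<lambda>x. g x - gradient \<phi> x) < \<epsilon> / 2"
        using H10_pair_approx[OF vg, of "\<epsilon> / 2"] by auto
      have "H1_norm \<Omega> (\<lambda>x. v x - \<phi> x) \<le> L2_norm \<Omega> (\<lambda>x. v x - \<phi> x) + L2_norm \<Omega> (\<lambda>x. g x - gradient \<phi> x)"
        unfolding norm_eq[OF g \<phi>(1)] by (intro sqrt_sum_squares_le_sum L2_norm_nonneg)
      then show "\<exists>\<phi>\<in>test_functions \<Omega>. H1_norm \<Omega> (\<lambda>x. v x - \<phi> x) < \<epsilon>"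
        using \<phi> by (intro bexI[of _ \<phi>]) auto
    qed
  qed
qed

section \<open>The Poincare inequality and extension by zero\<close>

lemma C_k_inner: "C_k k (\<lambda>x. x \<bullet> b)"
proof (cases k)
  case (Suc k')
  have d: "((\<lambda>x. x \<bullet> b) has_derivative (\<lambda>h. h \<bullet> b)) (at x)" for x
    by (auto intro!: derivative_eq_intros)
  then show ?thesis
    using Suc by (auto simp: partial_eqI[OF d] C_k_const differentiable_def)
qed (auto intro!: continuous_intros)

lemma L2_norm_minus_commute: "L2_norm \<Omega> (\<lambda>x. v x - w x) = L2_norm \<Omega> (\<lambda>x. w x - v x)"
  using L2_norm_scaleR[of \<Omega> "-1" "\<lambda>x. v x - w x"] by simp

text \<open>
  Integrating \<open>\<phi>\<^sup>2\<close> by parts against the derivative \<open>1\<close> of the coordinate \<open>x \<bullet> b\<close>, which is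
  bounded on \<open>\<Omega>\<close>, leaves \<open>- 2 (x \<bullet> b) \<phi> \<partial>\<phi>\<close>.
\<close>

lemma Poincare_test_function:
  assumes \<Omega>: "\<Omega> \<in> sets lebesgue" and L: "\<And>x. x \<in> \<Omega> \<Longrightarrow> norm x \<le> L" "0 \<le> L"
    and \<phi>: "\<phi> \<in> test_functions \<Omega>"
  shows "L2_norm \<Omega> \<phi> \<le> 2 * L * L2_norm \<Omega> (gradient \<phi>)"
proof -
  obtain b :: 'a where b: "b \<in> Basis" using nonempty_Basis by blast
  note s = test_function_smooth[OF \<phi>]
  note T = test_function_L2[OF \<Omega> \<phi>]
  obtain K where K: "compact K" "K \<subseteq> \<Omega>" "\<And>x b. x \<notin> K \<Longrightarrow> partial \<phi> b x = 0"
    using test_function_support[OF \<phi>] by metis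
  define q where "q = (\<lambda>x. (x \<bullet> b) * partial \<phi> b x)"
  have q: "q \<in> L2 \<Omega>"
    unfolding q_def using K
    by (intro continuous_compact_support_L2[OF \<Omega> _ K(1,2)] continuous_intros
        smooth_partial_continuous[OF s b]) auto
  have f: "\<forall>k. C_k k (\<lambda>x. (x \<bullet> b) * \<phi> x)"
    using s by (auto intro: C_k_mult C_k_inner)
  have pf: "partial (\<lambda>x. (x \<bullet> b) * \<phi> x) b x = q x + \<phi> x" for x
  proof -
    have i: "((\<lambda>x. x \<bullet> b) has_derivative (\<lambda>h. h \<bullet> b)) (at x)"
      by (auto intro!: derivative_eq_intros)
    show ?thesis
      using partial_eqI[OF has_derivative_mult[OF i differentiable_imp_has_derivative[OF smooth_differentiable[OF s]]], of b] b
      by (simp add: q_def inner_Basis)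
  qed
  have "(LINT x|lebesgue_on \<Omega>. (x \<bullet> b) * \<phi> x * partial \<phi> b x)
      = - (LINT x|lebesgue_on \<Omega>. (q x + \<phi> x) * \<phi> x)"
    using smooth_has_weak_gradient[OF \<Omega> f] b \<phi>
    by (simp add: has_weak_gradient_def gradient_inner_Basis pf)
  also have "(LINT x|lebesgue_on \<Omega>. (q x + \<phi> x) * \<phi> x) = L2_inner \<Omega> q \<phi> + L2_inner \<Omega> \<phi> \<phi>"
    using L2_inner_add_left[OF q T(1) T(1)] by (simp add: L2_inner_def)
  also have "(LINT x|lebesgue_on \<Omega>. (x \<bullet> b) * \<phi> x * partial \<phi> b x) = L2_inner \<Omega> q \<phi>"
    by (simp add: L2_inner_def q_def algebra_simps)
  finally have "(L2_norm \<Omega> \<phi>)\<^sup>2 = - (2 * L2_inner \<Omega> q \<phi>)"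
    by (simp add: L2_norm_square)
  also have "\<dots> \<le> 2 * (L2_norm \<Omega> q * L2_norm \<Omega> \<phi>)"
    using L2_Cauchy_Schwarz[OF q T(1)] by linarith
  also have "\<dots> \<le> 2 * ((L * L2_norm \<Omega> (gradient \<phi>)) * L2_norm \<Omega> \<phi>)"
  proof -
    have "L2_norm \<Omega> q \<le> L * L2_norm \<Omega> (gradient \<phi>)"
    proof (rule L2_norm_bounded_le[OF T(3) L2_measurable[OF q] L(2)], rule AE_I2)
      fix x assume "x \<in> space (lebesgue_on \<Omega>)"
      then have "\<bar>x \<bullet> b\<bar> \<le> L"
        using L(1)[of x] Basis_le_norm[OF b, of x] by simp
      moreover have "\<bar>partial \<phi> b x\<bar> \<le> norm (gradient \<phi> x)"
        using Basis_le_norm[OF b, of "gradient \<phi> x"] by (simp add: gradient_inner_Basis b)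
      ultimately show "norm (q x) \<le> L * norm (gradient \<phi> x)"
        using L(2) by (simp add: q_def abs_mult mult_mono)
    qed
    then show ?thesis
      by (intro mult_left_mono mult_right_mono L2_norm_nonneg) auto
  qed
  finally have "L2_norm \<Omega> \<phi> * L2_norm \<Omega> \<phi> \<le> (2 * L * L2_norm \<Omega> (gradient \<phi>)) * L2_norm \<Omega> \<phi>"
    by (simp add: power2_eq_square)
  then show ?thesis
    using L(2) L2_norm_nonneg[of \<Omega> \<phi>] L2_norm_nonneg[of \<Omega> "gradient \<phi>"]
    by (cases "L2_norm \<Omega> \<phi> = 0") auto
qed

lemma Poincare:
  assumes \<Omega>: "\<Omega> \<in> sets lebesgue" and L: "\<And>x. x \<in> \<Omega> \<Longrightarrow> norm x \<le> L" "0 \<le> L"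
    and vg: "H10_pair \<Omega> v g"
  shows "L2_norm \<Omega> v \<le> 2 * L * L2_norm \<Omega> g"
proof (rule field_le_epsilon)
  fix e :: real assume e: "e > 0"
  define \<delta> where "\<delta> = e / (1 + 2 * L)"
  have \<delta>: "\<delta> > 0" and \<delta>e: "\<delta> + 2 * L * \<delta> = e"
  proof -
    have "1 + 2 * L > 0" using L(2) by simp
    then show "\<delta> > 0" "\<delta> + 2 * L * \<delta> = e"
      using e unfolding \<delta>_def by (simp_all add: nonzero_eq_divide_eq flip: distrib_right add_divide_distrib) (simp add: field_simps)
  qed
  obtain \<phi> where \<phi>: "\<phi> \<in> test_functions \<Omega>" "L2_norm \<Omega> (\<lambda>x. v x - \<phi> x) < \<delta>"
    "L2_norm \<Omega> (\<lambda>x. g x - gradient \<phi> x) < \<delta>"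
    by (rule H10_pair_approx[OF vg \<delta>])
  note L2 = H10_pair_L2[OF vg] and T = test_function_L2[OF \<Omega> \<phi>(1)]
  have "L2_norm \<Omega> v \<le> L2_norm \<Omega> (\<lambda>x. v x - \<phi> x) + L2_norm \<Omega> \<phi>"
    using L2_norm_triangle[OF L2_diff[OF L2(1) T(1)] T(1)] by simp
  also have "\<dots> \<le> \<delta> + 2 * L * L2_norm \<Omega> (gradient \<phi>)"
    using \<phi>(2) Poincare_test_function[OF \<Omega> L \<phi>(1)] by simp
  also have "\<dots> \<le> \<delta> + 2 * L * (L2_norm \<Omega> g + \<delta>)"
  proof -
    have "L2_norm \<Omega> (gradient \<phi>) \<le> L2_norm \<Omega> g + L2_norm \<Omega> (\<lambda>x. gradient \<phi> x - g x)"
      using L2_norm_triangle[OF L2(2) L2_diff[OF T(3) L2(2)]] by simp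
    then have "L2_norm \<Omega> (gradient \<phi>) \<le> L2_norm \<Omega> g + \<delta>"
      using \<phi>(3) by (simp add: L2_norm_minus_commute[of \<Omega> g])
    then show ?thesis
      using L(2) by (intro add_left_mono mult_left_mono) auto
  qed
  also have "\<dots> = 2 * L * L2_norm \<Omega> g + e"
    using \<delta>e by (simp add: distrib_left)
  finally show "L2_norm \<Omega> v \<le> 2 * L * L2_norm \<Omega> g + e" .
qed

lemma L2_extend:
  fixes v :: "'a::euclidean_space \<Rightarrow> 'b::euclidean_space"
  assumes "\<omega> \<in> sets lebesgue" "\<Omega> \<in> sets lebesgue" "\<omega> \<subseteq> \<Omega>" "v \<in> L2 \<omega>"
  shows "(\<lambda>x. if x \<in> \<omega> then v x else 0) \<in> L2 \<Omega>"
    and "L2_norm \<Omega> (\<lambda>x. if x \<in> \<omega> then v x else 0) = L2_norm \<omega> v"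
proof -
  let ?w = "\<lambda>x. if x \<in> \<omega> then v x else 0"
  have sq: "(norm (?w x))\<^sup>2 = (if x \<in> \<omega> then (norm (v x))\<^sup>2 else 0)" for x by simp
  have "?w \<in> borel_measurable (lebesgue_on \<Omega>)"
    by (intro measurable_restrict_space1 borel_measurable_if_I L2_measurable assms)
  moreover have "integrable (lebesgue_on \<Omega>) (\<lambda>x. (norm (?w x))\<^sup>2)"
    using assms unfolding sq
    by (subst integral_lebesgue_on_vanishing(2))
      (auto simp: Lebesgue_Measure.integrable_restrict_UNIV L2_def)
  ultimately show "?w \<in> L2 \<Omega>" by (simp add: L2_def)
  show "L2_norm \<Omega> ?w = L2_norm \<omega> v"
    unfolding L2_norm_def L2_inner_self sq using integral_restrict[OF assms(3,1,2)] by simp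
qed

text \<open>
  A test function on \<open>\<omega>\<close> is one on \<open>\<Omega>\<close> and vanishes outside \<open>\<omega>\<close> together with its gradient, so the
  same approximations serve both domains.
\<close>

lemma H10_pair_extend:
  assumes \<omega>: "\<omega> \<in> sets lebesgue" and \<Omega>: "\<Omega> \<in> sets lebesgue" and sub: "\<omega> \<subseteq> \<Omega>" and vg: "H10_pair \<omega> v g"
  shows "H10_pair \<Omega> (\<lambda>x. if x \<in> \<omega> then v x else 0) (\<lambda>x. if x \<in> \<omega> then g x else 0)"
  unfolding H10_pair_def
proof (intro conjI allI impI)
  note L2 = H10_pair_L2[OF vg]
  show "(\<lambda>x. if x \<in> \<omega> then v x else 0) \<in> L2 \<Omega>" "(\<lambda>x. if x \<in> \<omega> then g x else 0) \<in> L2 \<Omega>"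
    by (intro L2_extend \<omega> \<Omega> sub L2)+
  fix \<epsilon> :: real assume "\<epsilon> > 0"
  with vg obtain \<phi> where \<phi>: "\<phi> \<in> test_functions \<omega>" "L2_norm \<omega> (\<lambda>x. v x - \<phi> x) < \<epsilon>"
    "L2_norm \<omega> (\<lambda>x. g x - gradient \<phi> x) < \<epsilon>"
    by (rule H10_pair_approx)
  obtain K where "K \<subseteq> \<omega>" "\<And>x. x \<notin> K \<Longrightarrow> \<phi> x = 0" "\<And>x. x \<notin> K \<Longrightarrow> gradient \<phi> x = 0"
    using test_function_support[OF \<phi>(1)] by metis
  then have "(\<lambda>x. (if x \<in> \<omega> then v x else 0) - \<phi> x) = (\<lambda>x. if x \<in> \<omega> then v x - \<phi> x else 0)"
    "(\<lambda>x. (if x \<in> \<omega> then g x else 0) - gradient \<phi> x) = (\<lambda>x. if x \<in> \<omega> then g x - gradient \<phi> x else 0)"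
    by (auto simp: fun_eq_iff)
  then show "\<exists>\<phi>\<in>test_functions \<Omega>. L2_norm \<Omega> (\<lambda>x. (if x \<in> \<omega> then v x else 0) - \<phi> x) < \<epsilon>
      \<and> L2_norm \<Omega> (\<lambda>x. (if x \<in> \<omega> then g x else 0) - gradient \<phi> x) < \<epsilon>"
    using \<phi> test_functions_mono[OF sub] L2_extend(2)[OF \<omega> \<Omega> sub L2_diff[OF L2(1) test_function_L2(1)[OF \<omega> \<phi>(1)]]]
      L2_extend(2)[OF \<omega> \<Omega> sub L2_diff[OF L2(2) test_function_L2(3)[OF \<omega> \<phi>(1)]]]
    by (intro bexI[of _ \<phi>]) auto
qed

lemma H10_AE:
  assumes "open \<Omega>" "v \<in> H10 \<Omega>" "AE x in lebesgue_on \<Omega>. v x = w x"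
  shows "w \<in> H10 \<Omega>"
  using assms H10_pair_AE[of \<Omega> v _ w] by (auto simp: H10_iff_H10_pair)

lemma H10_add: "open \<Omega> \<Longrightarrow> v \<in> H10 \<Omega> \<Longrightarrow> w \<in> H10 \<Omega> \<Longrightarrow> (\<lambda>x. v x + w x) \<in> H10 \<Omega>"
  using H10_pair_add[of \<Omega> v _ w] by (auto simp: H10_iff_H10_pair)

lemma H10_scale: "open \<Omega> \<Longrightarrow> v \<in> H10 \<Omega> \<Longrightarrow> (\<lambda>x. c * v x) \<in> H10 \<Omega>"
  using H10_pair_scale[of \<Omega> v] by (auto simp: H10_iff_H10_pair)

lemma H10_diff: "open \<Omega> \<Longrightarrow> v \<in> H10 \<Omega> \<Longrightarrow> w \<in> H10 \<Omega> \<Longrightarrow> (\<lambda>x. v x - w x) \<in> H10 \<Omega>"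
  using H10_add[OF _ _ H10_scale, of \<Omega> v w "-1"] by simp

lemma H10_zero: "open \<Omega> \<Longrightarrow> (\<lambda>x. 0) \<in> H10 \<Omega>"
  using test_function_H10_pair[OF _ zero_test_function, of \<Omega>] by (auto simp: H10_iff_H10_pair)

lemma H10_ext_subset_H10:
  assumes "open \<omega>" "open \<Omega>" "\<omega> \<subseteq> \<Omega>"
  shows "H10_ext \<Omega> \<omega> \<subseteq> H10 \<Omega>"
proof
  fix v assume "v \<in> H10_ext \<Omega> \<omega>"
  then obtain w where w: "w \<in> H10 \<omega>" "AE x in lebesgue_on \<Omega>. v x = (if x \<in> \<omega> then w x else 0)"
    by (auto simp: H10_ext_def ae_eq_def)
  obtain g where "H10_pair \<omega> w g" using w(1) assms(1) by (auto simp: H10_iff_H10_pair)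
  from H10_pair_extend[OF _ _ assms(3) this] assms
  have "(\<lambda>x. if x \<in> \<omega> then w x else 0) \<in> H10 \<Omega>" by (auto simp: H10_iff_H10_pair)
  moreover have "AE x in lebesgue_on \<Omega>. (if x \<in> \<omega> then w x else 0) = v x"
    using w(2) by eventually_elim simp
  ultimately show "v \<in> H10 \<Omega>" using H10_AE[OF assms(2)] by blast
qed

text \<open>
  This guarantees that a local dual norm is a supremum over a nonempty set, without which its value
  would be arbitrary.
\<close>

lemma H10_ext_nonzero_elements:
  assumes \<omega>: "open \<omega>" "\<omega> \<noteq> {}" and \<Omega>: "open \<Omega>" "\<omega> \<subseteq> \<Omega>"
  shows "nonzero_elements \<Omega> (H10_ext \<Omega> \<omega>) \<noteq> {}"
proof -
  obtain y where y: "y \<in> \<omega>" using \<omega>(2) by blast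
  obtain a b where ab: "y \<in> box a b" "cbox a b \<subseteq> \<omega>"
    using open_contains_cbox[OF \<omega>(1)] y by metis
  let ?\<phi> = "box_bump a b 1"
  have \<phi>: "?\<phi> \<in> test_functions \<omega>" by (rule box_bump_test_function[OF ab(2)])
  have "?\<phi> \<in> H10 \<omega>"
    using test_function_H10_pair[OF _ \<phi>] \<omega>(1) by (auto simp: H10_iff_H10_pair)
  moreover have "?\<phi> x = (if x \<in> \<omega> then ?\<phi> x else 0)" for x
    using box_bump_outside[of x a b 1] ab(2) box_subset_cbox[of a b] by auto
  ultimately have "?\<phi> \<in> H10_ext \<Omega> \<omega>"
    unfolding H10_ext_def ae_eq_def mem_Collect_eq by (intro bexI[of _ ?\<phi>]) auto
  moreover have "\<not> ae_eq \<Omega> ?\<phi> (\<lambda>_. 0)"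
  proof
    assume "ae_eq \<Omega> ?\<phi> (\<lambda>_. 0)"
    then have "AE x in lebesgue. x \<in> \<Omega> \<longrightarrow> ?\<phi> x = 0"
      using \<Omega>(1) by (simp add: ae_eq_def AE_restrict_space_iff)
    then have "AE x in lebesgue. x \<notin> box a b"
    proof eventually_elim
      case (elim x)
      then show ?case
        using box_bump_pos[of x a b 1] ab(2) \<Omega>(2) box_subset_cbox[of a b] by fastforce
    qed
    then have "y \<in> - box a b"
      by (intro mem_closed_if_AE_lebesgue) (auto simp: closed_Compl)
    with ab(1) show False by simp
  qed
  ultimately show ?thesis by (auto simp: nonzero_elements_def)
qed

section \<open>The energy form\<close>

locale diffusion =
  fixes \<Omega> :: "'a::euclidean_space set" and \<kappa> :: "'a \<Rightarrow> real" and \<kappa>min \<kappa>max :: real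
  assumes open_domain: "open \<Omega>"
    and bounded_domain: "bounded \<Omega>"
    and \<kappa>_measurable: "\<kappa> \<in> borel_measurable (lebesgue_on \<Omega>)"
    and \<kappa>min_pos: "0 < \<kappa>min"
    and \<kappa>_bounds: "AE x in lebesgue_on \<Omega>. \<kappa>min \<le> \<kappa> x \<and> \<kappa> x \<le> \<kappa>max"
begin

lemma domain_measurable: "\<Omega> \<in> sets lebesgue"
  using open_domain by simp

lemma sqrt_\<kappa>_Linf: "(\<lambda>x. sqrt (\<kappa> x)) \<in> Linf \<Omega>"
proof -
  note [measurable] = \<kappa>_measurable
  have "AE x in lebesgue_on \<Omega>. norm (sqrt (\<kappa> x)) \<le> sqrt \<kappa>max"
    using \<kappa>_bounds by eventually_elim (use \<kappa>min_pos in auto)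
  then show ?thesis unfolding Linf_def by auto
qed

text \<open>
  The energy form is the \<open>L\<^sup>2\<close> inner product of the gradients weighted with the square root of the
  conductivity, so that it inherits bilinearity and the Cauchy--Schwarz inequality.
\<close>

lemma energy_eq_L2_inner:
  assumes vg: "H10_pair \<Omega> v g" and wh: "H10_pair \<Omega> w h"
  shows "energy \<Omega> \<kappa> v w = L2_inner \<Omega> (\<lambda>x. sqrt (\<kappa> x) *\<^sub>R g x) (\<lambda>x. sqrt (\<kappa> x) *\<^sub>R h x)"
  unfolding energy_def L2_inner_def
proof (rule integral_lebesgue_on_AE[OF domain_measurable, symmetric])
  show "integrable (lebesgue_on \<Omega>) (\<lambda>x. (sqrt (\<kappa> x) *\<^sub>R g x) \<bullet> (sqrt (\<kappa> x) *\<^sub>R h x))"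
    by (intro L2_inner_integrable L2_bounded_scaleR sqrt_\<kappa>_Linf H10_pair_L2[OF vg] H10_pair_L2[OF wh])
  show "AE x in lebesgue_on \<Omega>. (sqrt (\<kappa> x) *\<^sub>R g x) \<bullet> (sqrt (\<kappa> x) *\<^sub>R h x)
      = \<kappa> x * (weak_gradient \<Omega> v x \<bullet> weak_gradient \<Omega> w x)"
    using \<kappa>_bounds H10_pair_weak_gradient[OF open_domain vg] H10_pair_weak_gradient[OF open_domain wh]
    by eventually_elim (use \<kappa>min_pos in simp)
qed

lemma weighted_L2: "H10_pair \<Omega> v g \<Longrightarrow> (\<lambda>x. sqrt (\<kappa> x) *\<^sub>R g x) \<in> L2 \<Omega>"
  by (intro L2_bounded_scaleR sqrt_\<kappa>_Linf H10_pair_L2)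

lemma H10_obtain_pair:
  assumes "v \<in> H10 \<Omega>"
  obtains g where "H10_pair \<Omega> v g"
  using assms open_domain by (auto simp: H10_iff_H10_pair)

lemma energy_commute: "energy \<Omega> \<kappa> v w = energy \<Omega> \<kappa> w v"
  by (simp add: energy_def inner_commute)

lemma energy_add_left:
  assumes "v \<in> H10 \<Omega>" "w \<in> H10 \<Omega>" "z \<in> H10 \<Omega>"
  shows "energy \<Omega> \<kappa> (\<lambda>x. v x + w x) z = energy \<Omega> \<kappa> v z + energy \<Omega> \<kappa> w z"
proof -
  obtain g h k where p: "H10_pair \<Omega> v g" "H10_pair \<Omega> w h" "H10_pair \<Omega> z k"
    using assms H10_obtain_pair by metis
  show ?thesis
    unfolding energy_eq_L2_inner[OF p(1,3)] energy_eq_L2_inner[OF p(2,3)]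
      energy_eq_L2_inner[OF H10_pair_add[OF domain_measurable p(1,2)] p(3)]
    using L2_inner_add_left[OF weighted_L2[OF p(1)] weighted_L2[OF p(2)] weighted_L2[OF p(3)]]
    by (simp add: scaleR_add_right)
qed

lemma energy_scale_left:
  assumes "v \<in> H10 \<Omega>" "z \<in> H10 \<Omega>"
  shows "energy \<Omega> \<kappa> (\<lambda>x. c * v x) z = c * energy \<Omega> \<kappa> v z"
proof -
  obtain g k where p: "H10_pair \<Omega> v g" "H10_pair \<Omega> z k"
    using assms H10_obtain_pair by metis
  show ?thesis
    unfolding energy_eq_L2_inner[OF p] energy_eq_L2_inner[OF H10_pair_scale[OF p(1)] p(2)]
    by (simp add: L2_inner_scaleR_left[symmetric] mult.commute)
qed

lemma energy_diff_left:
  assumes "v \<in> H10 \<Omega>" "w \<in> H10 \<Omega>" "z \<in> H10 \<Omega>"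
  shows "energy \<Omega> \<kappa> (\<lambda>x. v x - w x) z = energy \<Omega> \<kappa> v z - energy \<Omega> \<kappa> w z"
  using energy_add_left[OF assms(1) H10_scale[OF open_domain assms(2), of "-1"] assms(3)]
    energy_scale_left[OF assms(2,3), of "-1"] by simp

lemma energy_diff_square:
  assumes "v \<in> H10 \<Omega>" "w \<in> H10 \<Omega>"
  shows "energy \<Omega> \<kappa> (\<lambda>x. v x - w x) (\<lambda>x. v x - w x)
       = energy \<Omega> \<kappa> v v - 2 * energy \<Omega> \<kappa> v w + energy \<Omega> \<kappa> w w"
proof -
  let ?d = "\<lambda>x. v x - w x"
  have "energy \<Omega> \<kappa> ?d ?d = energy \<Omega> \<kappa> v ?d - energy \<Omega> \<kappa> w ?d"
    by (intro energy_diff_left assms H10_diff open_domain)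
  also have "\<dots> = energy \<Omega> \<kappa> ?d v - energy \<Omega> \<kappa> ?d w"
    by (simp only: energy_commute)
  finally show ?thesis
    using assms energy_commute[of w v] by (simp add: energy_diff_left)
qed

lemma energy_AE:
  assumes "v \<in> H10 \<Omega>" "z \<in> H10 \<Omega>" "AE x in lebesgue_on \<Omega>. v x = w x"
  shows "energy \<Omega> \<kappa> v z = energy \<Omega> \<kappa> w z"
proof -
  obtain g k where p: "H10_pair \<Omega> v g" "H10_pair \<Omega> z k"
    using assms H10_obtain_pair by metis
  show ?thesis
    using energy_eq_L2_inner[OF p] energy_eq_L2_inner[OF H10_pair_AE[OF domain_measurable p(1) assms(3), of g] p(2)]
    by simp
qed

lemma energy_norm_eq_L2_norm:
  "H10_pair \<Omega> v g \<Longrightarrow> energy_norm \<Omega> \<kappa> v = L2_norm \<Omega> (\<lambda>x. sqrt (\<kappa> x) *\<^sub>R g x)"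
  by (simp add: energy_norm_def L2_norm_def energy_eq_L2_inner)

lemma energy_nonneg: "v \<in> H10 \<Omega> \<Longrightarrow> 0 \<le> energy \<Omega> \<kappa> v v"
  using H10_obtain_pair energy_eq_L2_inner L2_inner_self_nonneg by metis

lemma energy_norm_nonneg: "v \<in> H10 \<Omega> \<Longrightarrow> 0 \<le> energy_norm \<Omega> \<kappa> v"
  by (simp add: energy_norm_def energy_nonneg)

lemma energy_norm_square: "v \<in> H10 \<Omega> \<Longrightarrow> (energy_norm \<Omega> \<kappa> v)\<^sup>2 = energy \<Omega> \<kappa> v v"
  by (simp add: energy_norm_def energy_nonneg)

lemma energy_Cauchy_Schwarz:
  assumes "v \<in> H10 \<Omega>" "w \<in> H10 \<Omega>"
  shows "energy \<Omega> \<kappa> v w \<le> energy_norm \<Omega> \<kappa> v * energy_norm \<Omega> \<kappa> w"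
proof -
  obtain g h where p: "H10_pair \<Omega> v g" "H10_pair \<Omega> w h"
    using assms H10_obtain_pair by metis
  show ?thesis
    using L2_Cauchy_Schwarz[OF weighted_L2[OF p(1)] weighted_L2[OF p(2)]]
    by (simp add: energy_norm_eq_L2_norm[OF p(1)] energy_norm_eq_L2_norm[OF p(2)] energy_eq_L2_inner[OF p])
qed

lemma energy_sum_left:
  assumes "finite I" "\<And>i. i \<in> I \<Longrightarrow> v i \<in> H10 \<Omega>" "z \<in> H10 \<Omega>"
  shows "(\<lambda>x. \<Sum>i\<in>I. v i x) \<in> H10 \<Omega> \<and>
    energy \<Omega> \<kappa> (\<lambda>x. \<Sum>i\<in>I. v i x) z = (\<Sum>i\<in>I. energy \<Omega> \<kappa> (v i) z)"
  using assms
proof (induction I rule: finite_induct)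
  case empty
  have "energy \<Omega> \<kappa> (\<lambda>x. 0) z = 0"
    using energy_scale_left[OF H10_zero[OF open_domain] empty(2), of 0] by simp
  then show ?case by (simp add: H10_zero open_domain)
next
  case (insert i I)
  then show ?case by (simp add: H10_add open_domain energy_add_left)
qed

lemma energy_norm_zero_element:
  assumes "v \<in> H10 \<Omega>" "ae_eq \<Omega> v (\<lambda>_. 0)"
  shows "energy_norm \<Omega> \<kappa> v = 0"
proof -
  have "energy \<Omega> \<kappa> v v = energy \<Omega> \<kappa> (\<lambda>_. 0) v"
    using assms by (intro energy_AE) (auto simp: ae_eq_def)
  also have "\<dots> = 0"
    using energy_scale_left[OF assms(1,1), of 0] by simp
  finally show ?thesis by (simp add: energy_norm_def)
qed

lemma energy_norm_bounds:
  assumes vg: "H10_pair \<Omega> v g"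
  shows "energy_norm \<Omega> \<kappa> v \<le> sqrt \<bar>\<kappa>max\<bar> * L2_norm \<Omega> g"
    and "L2_norm \<Omega> g \<le> inverse (sqrt \<kappa>min) * energy_norm \<Omega> \<kappa> v"
proof -
  note g = H10_pair_L2(2)[OF vg] and w = weighted_L2[OF vg]
  show "energy_norm \<Omega> \<kappa> v \<le> sqrt \<bar>\<kappa>max\<bar> * L2_norm \<Omega> g"
    unfolding energy_norm_eq_L2_norm[OF vg]
  proof (rule L2_norm_bounded_le[OF g L2_measurable[OF w]])
    show "AE x in lebesgue_on \<Omega>. norm (sqrt (\<kappa> x) *\<^sub>R g x) \<le> sqrt \<bar>\<kappa>max\<bar> * norm (g x)"
      using \<kappa>_bounds by eventually_elim (use \<kappa>min_pos in \<open>auto intro!: mult_right_mono\<close>)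
  qed simp
  show "L2_norm \<Omega> g \<le> inverse (sqrt \<kappa>min) * energy_norm \<Omega> \<kappa> v"
    unfolding energy_norm_eq_L2_norm[OF vg]
  proof (rule L2_norm_bounded_le[OF w L2_measurable[OF g]])
    show "AE x in lebesgue_on \<Omega>. norm (g x) \<le> inverse (sqrt \<kappa>min) * norm (sqrt (\<kappa> x) *\<^sub>R g x)"
      using \<kappa>_bounds
    proof eventually_elim
      case (elim x)
      have "norm (g x) = inverse (sqrt \<kappa>min) * (sqrt \<kappa>min * norm (g x))"
        using \<kappa>min_pos by simp
      also have "\<dots> \<le> inverse (sqrt \<kappa>min) * (sqrt (\<kappa> x) * norm (g x))"
        using elim \<kappa>min_pos by (intro mult_left_mono mult_right_mono) auto
      finally show ?case using elim \<kappa>min_pos by simp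
    qed
  qed (use \<kappa>min_pos in simp)
qed

text \<open>
  The gradient of \<open>\<rho> \<phi>\<close> is \<open>\<rho> \<nabla>\<phi> + \<phi> \<nabla>\<rho>\<close>. The Poincare inequality controls the second term by
  \<open>\<nabla>\<phi>\<close>. The bound makes the supremum in the definition of \<open>c_pu\<close> finite.
\<close>

lemma energy_norm_W1inf_mult_bounded:
  assumes \<rho>: "\<rho> \<in> W1inf \<Omega>"
  obtains C where "0 \<le> C" "\<And>\<phi>. \<phi> \<in> H10 \<Omega> \<Longrightarrow> (\<lambda>x. \<rho> x * \<phi> x) \<in> H10 \<Omega> \<Longrightarrow>
    energy_norm \<Omega> \<kappa> (\<lambda>x. \<rho> x * \<phi> x) \<le> C * energy_norm \<Omega> \<kappa> \<phi>"
proof -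
  obtain r where \<rho>L: "\<rho> \<in> Linf \<Omega>" and rL: "r \<in> Linf \<Omega>" and \<rho>r: "has_weak_gradient \<Omega> \<rho> r"
    using \<rho> by (auto simp: W1inf_def)
  obtain A where A: "AE x in lebesgue_on \<Omega>. norm (\<rho> x) \<le> A" using \<rho>L by (auto simp: Linf_def)
  obtain B where B: "AE x in lebesgue_on \<Omega>. norm (r x) \<le> B" using rL by (auto simp: Linf_def)
  obtain L where L: "\<And>x. x \<in> \<Omega> \<Longrightarrow> norm x \<le> L" "0 \<le> L"
    using bounded_domain by (meson bounded_pos less_imp_le)
  define C where "C = sqrt \<bar>\<kappa>max\<bar> * ((\<bar>A\<bar> + \<bar>B\<bar> * (2 * L)) * inverse (sqrt \<kappa>min))"
  show ?thesis
  proof (rule that)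
    show "0 \<le> C" using L(2) \<kappa>min_pos by (simp add: C_def)
    fix \<phi> assume \<phi>: "\<phi> \<in> H10 \<Omega>" and \<rho>\<phi>: "(\<lambda>x. \<rho> x * \<phi> x) \<in> H10 \<Omega>"
    obtain g where g: "H10_pair \<Omega> \<phi> g" using \<phi> H10_obtain_pair by blast
    obtain h where h: "H10_pair \<Omega> (\<lambda>x. \<rho> x * \<phi> x) h" using \<rho>\<phi> H10_obtain_pair by blast
    let ?G = "\<lambda>x. \<rho> x *\<^sub>R g x + \<phi> x *\<^sub>R r x"
    have eq: "AE x in lebesgue_on \<Omega>. h x = ?G x"
      by (rule has_weak_gradient_AE_unique[OF open_domain H10_pair_has_weak_gradient[OF domain_measurable h]
            H10_pair_product_rule[OF domain_measurable g \<rho>L rL \<rho>r]]) simp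
    note L2 = L2_bounded_scaleR[OF \<rho>L H10_pair_L2(2)[OF g]] L2_bounded_swap[OF rL H10_pair_L2(1)[OF g]]
    have "L2_norm \<Omega> h = L2_norm \<Omega> ?G"
      by (rule L2_norm_AE[OF domain_measurable H10_pair_L2(2)[OF h] eq])
    also have "\<dots> \<le> L2_norm \<Omega> (\<lambda>x. \<rho> x *\<^sub>R g x) + L2_norm \<Omega> (\<lambda>x. \<phi> x *\<^sub>R r x)"
      by (rule L2_norm_triangle[OF L2])
    also have "\<dots> \<le> \<bar>A\<bar> * L2_norm \<Omega> g + \<bar>B\<bar> * L2_norm \<Omega> \<phi>"
    proof (rule add_mono)
      show "L2_norm \<Omega> (\<lambda>x. \<rho> x *\<^sub>R g x) \<le> \<bar>A\<bar> * L2_norm \<Omega> g"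
      proof (rule L2_norm_bounded_le[OF H10_pair_L2(2)[OF g] L2_measurable[OF L2(1)]])
        show "AE x in lebesgue_on \<Omega>. norm (\<rho> x *\<^sub>R g x) \<le> \<bar>A\<bar> * norm (g x)"
          using A by eventually_elim (auto intro: mult_right_mono)
      qed simp
      show "L2_norm \<Omega> (\<lambda>x. \<phi> x *\<^sub>R r x) \<le> \<bar>B\<bar> * L2_norm \<Omega> \<phi>"
      proof (rule L2_norm_bounded_le[OF H10_pair_L2(1)[OF g] L2_measurable[OF L2(2)]])
        show "AE x in lebesgue_on \<Omega>. norm (\<phi> x *\<^sub>R r x) \<le> \<bar>B\<bar> * norm (\<phi> x)"
          using B
        proof eventually_elim
          case (elim x)
          then have "norm (r x) * \<bar>\<phi> x\<bar> \<le> \<bar>B\<bar> * \<bar>\<phi> x\<bar>" by (intro mult_right_mono) auto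
          then show ?case by (simp add: mult.commute)
        qed
      qed simp
    qed
    also have "\<dots> \<le> \<bar>A\<bar> * L2_norm \<Omega> g + \<bar>B\<bar> * (2 * L * L2_norm \<Omega> g)"
      by (intro add_left_mono mult_left_mono Poincare[OF domain_measurable L g]) auto
    also have "\<dots> = (\<bar>A\<bar> + \<bar>B\<bar> * (2 * L)) * L2_norm \<Omega> g"
      by (simp add: algebra_simps)
    also have "\<dots> \<le> (\<bar>A\<bar> + \<bar>B\<bar> * (2 * L)) * (inverse (sqrt \<kappa>min) * energy_norm \<Omega> \<kappa> \<phi>)"
      using L(2) by (intro mult_left_mono energy_norm_bounds[OF g]) auto
    finally have "L2_norm \<Omega> h \<le> (\<bar>A\<bar> + \<bar>B\<bar> * (2 * L)) * (inverse (sqrt \<kappa>min) * energy_norm \<Omega> \<kappa> \<phi>)" .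
    then have "sqrt \<bar>\<kappa>max\<bar> * L2_norm \<Omega> h \<le> C * energy_norm \<Omega> \<kappa> \<phi>"
      unfolding C_def mult.assoc by (intro mult_left_mono) auto
    with energy_norm_bounds(1)[OF h]
    show "energy_norm \<Omega> \<kappa> (\<lambda>x. \<rho> x * \<phi> x) \<le> C * energy_norm \<Omega> \<kappa> \<phi>" by linarith
  qed
qed

lemma c_pu_bound:
  assumes \<rho>: "\<And>i. i \<in> {1..N} \<Longrightarrow> \<rho> i \<in> W1inf \<Omega>"
    and mult: "\<And>i \<phi>. i \<in> {1..N} \<Longrightarrow> \<phi> \<in> H10 \<Omega> \<Longrightarrow> (\<lambda>x. \<rho> i x * \<phi> x) \<in> H10 \<Omega>"
    and \<phi>: "\<phi> \<in> H10 \<Omega>" "energy_norm \<Omega> \<kappa> \<phi> \<noteq> 0"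
  shows "(\<Sum>i=1..N. (energy_norm \<Omega> \<kappa> (\<lambda>x. \<rho> i x * \<phi> x))\<^sup>2) \<le> (c_pu \<Omega> \<kappa> N \<rho>)\<^sup>2 * (energy_norm \<Omega> \<kappa> \<phi>)\<^sup>2"
proof -
  let ?q = "\<lambda>\<phi>. (\<Sum>i=1..N. (energy_norm \<Omega> \<kappa> (\<lambda>x. \<rho> i x * \<phi> x))\<^sup>2) / (energy_norm \<Omega> \<kappa> \<phi>)\<^sup>2"
  let ?Z = "nonzero_elements \<Omega> (H10 \<Omega>)"
  have "\<forall>i\<in>{1..N}. \<exists>C\<ge>0. \<forall>\<phi>\<in>H10 \<Omega>.
      energy_norm \<Omega> \<kappa> (\<lambda>x. \<rho> i x * \<phi> x) \<le> C * energy_norm \<Omega> \<kappa> \<phi>"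
    using energy_norm_W1inf_mult_bounded[OF \<rho>] mult by metis
  then obtain C where C: "\<And>i \<phi>. i \<in> {1..N} \<Longrightarrow> \<phi> \<in> H10 \<Omega> \<Longrightarrow>
      energy_norm \<Omega> \<kappa> (\<lambda>x. \<rho> i x * \<phi> x) \<le> C i * energy_norm \<Omega> \<kappa> \<phi>"
    by metis
  have bound: "?q \<psi> \<le> (\<Sum>i=1..N. (C i)\<^sup>2)" if \<psi>: "\<psi> \<in> H10 \<Omega>" for \<psi>
  proof (cases "energy_norm \<Omega> \<kappa> \<psi> = 0")
    case False
    have "(\<Sum>i=1..N. (energy_norm \<Omega> \<kappa> (\<lambda>x. \<rho> i x * \<psi> x))\<^sup>2) \<le> (\<Sum>i=1..N. (C i)\<^sup>2 * (energy_norm \<Omega> \<kappa> \<psi>)\<^sup>2)"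
      unfolding power_mult_distrib[symmetric]
      by (intro sum_mono power_mono C \<psi> energy_norm_nonneg mult)
    then show ?thesis
      using False by (simp add: divide_le_eq sum_distrib_right)
  qed (simp add: sum_nonneg)
  have "bdd_above (?q ` ?Z)"
    using bound by (intro bdd_aboveI2) (auto simp: nonzero_elements_def)
  moreover have "\<phi> \<in> ?Z"
    using \<phi> energy_norm_zero_element by (auto simp: nonzero_elements_def)
  ultimately have le: "?q \<phi> \<le> (SUP \<phi>\<in>?Z. ?q \<phi>)"
    by (rule cSUP_upper[rotated])
  have "0 \<le> ?q \<phi>" by (intro divide_nonneg_nonneg sum_nonneg) auto
  with le have "(c_pu \<Omega> \<kappa> N \<rho>)\<^sup>2 = (SUP \<phi>\<in>?Z. ?q \<phi>)"
    by (simp add: c_pu_def)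
  with le show ?thesis
    using \<phi>(2) by (simp add: divide_le_eq)
qed

text \<open>
  The Cauchy--Schwarz inequality; as the bound is uniform in \<open>\<phi>\<close>, it shows that the supremum in the
  dual norm is finite.
\<close>

lemma representer_quotient_le:
  assumes W: "W \<subseteq> H10 \<Omega>" and r: "r \<in> H10 \<Omega>" and R: "\<And>\<phi>. \<phi> \<in> W \<Longrightarrow> R \<phi> = energy \<Omega> \<kappa> r \<phi>" and \<phi>: "\<phi> \<in> W"
  shows "R \<phi> / energy_norm \<Omega> \<kappa> \<phi> \<le> energy_norm \<Omega> \<kappa> r"
proof (cases "energy_norm \<Omega> \<kappa> \<phi> = 0")
  case False
  have \<phi>': "\<phi> \<in> H10 \<Omega>" using W \<phi> by blast
  have "energy_norm \<Omega> \<kappa> \<phi> > 0" using False energy_norm_nonneg[OF \<phi>'] by simp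
  then show ?thesis
    using energy_Cauchy_Schwarz[OF r \<phi>'] by (simp add: divide_le_eq R[OF \<phi>])
qed (simp add: energy_norm_nonneg r)

lemma le_dual_norm_mult:
  assumes W: "W \<subseteq> H10 \<Omega>" and r: "r \<in> H10 \<Omega>" and R: "\<And>\<phi>. \<phi> \<in> W \<Longrightarrow> R \<phi> = energy \<Omega> \<kappa> r \<phi>" and \<phi>: "\<phi> \<in> W"
  shows "R \<phi> \<le> dual_norm \<Omega> \<kappa> W R * energy_norm \<Omega> \<kappa> \<phi>"
proof (cases "energy_norm \<Omega> \<kappa> \<phi> = 0")
  case True
  then show ?thesis
    using energy_Cauchy_Schwarz[OF r, of \<phi>] W \<phi> by (auto simp: R)
next
  case False
  have \<phi>': "\<phi> \<in> H10 \<Omega>" using W \<phi> by blast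
  have pos: "energy_norm \<Omega> \<kappa> \<phi> > 0" using False energy_norm_nonneg[OF \<phi>'] by simp
  have "R \<phi> / energy_norm \<Omega> \<kappa> \<phi> \<le> dual_norm \<Omega> \<kappa> W R"
    unfolding dual_norm_def
  proof (rule cSUP_upper)
    show "\<phi> \<in> nonzero_elements \<Omega> W"
      using False \<phi> \<phi>' energy_norm_zero_element by (auto simp: nonzero_elements_def)
    show "bdd_above ((\<lambda>\<phi>. R \<phi> / energy_norm \<Omega> \<kappa> \<phi>) ` nonzero_elements \<Omega> W)"
      using representer_quotient_le[OF W r R]
      by (intro bdd_aboveI2) (auto simp: nonzero_elements_def)
  qed
  with pos show ?thesis by (simp add: divide_le_eq)
qed

lemma dual_norm_le_representer:
  assumes W: "W \<subseteq> H10 \<Omega>" and r: "r \<in> H10 \<Omega>" and R: "\<And>\<phi>. \<phi> \<in> W \<Longrightarrow> R \<phi> = energy \<Omega> \<kappa> r \<phi>"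
    and ne: "nonzero_elements \<Omega> W \<noteq> {}"
  shows "dual_norm \<Omega> \<kappa> W R \<le> energy_norm \<Omega> \<kappa> r"
  unfolding dual_norm_def
  using ne representer_quotient_le[OF W r R] by (intro cSUP_least) (auto simp: nonzero_elements_def)

text \<open>
  Splitting \<open>e\<close> by the partition of unity turns \<open>a(e, e)\<close> into local contributions, each bounded by a
  local dual norm. Passing from the sum of the \<open>N\<close> local norms to the sum of their squares costs
  the factor \<open>N\<close>, and bounding the latter by the global norm costs \<open>c\<^sub>p\<^sub>u\<^sup>2\<close>.
\<close>

lemma energy_le_maximal_dual_norm:
  assumes \<rho>: "\<And>i. i \<in> {1..N} \<Longrightarrow> \<rho> i \<in> W1inf \<Omega>"
    and \<rho>_sum: "AE x in lebesgue_on \<Omega>. (\<Sum>i=1..N. \<rho> i x) = 1"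
    and W: "\<And>i. i \<in> {1..N} \<Longrightarrow> W i \<subseteq> H10 \<Omega>"
    and local: "\<And>i \<phi>. i \<in> {1..N} \<Longrightarrow> \<phi> \<in> H10 \<Omega> \<Longrightarrow> (\<lambda>x. \<rho> i x * \<phi> x) \<in> W i"
    and e: "e \<in> H10 \<Omega>" and R: "\<And>\<phi>. \<phi> \<in> H10 \<Omega> \<Longrightarrow> R \<phi> = energy \<Omega> \<kappa> e \<phi>"
    and max: "\<And>i. i \<in> {1..N} \<Longrightarrow> dual_norm \<Omega> \<kappa> (W i) R \<le> D"
    and pos: "energy \<Omega> \<kappa> e e > 0"
  shows "D > 0" "energy \<Omega> \<kappa> e e \<le> D\<^sup>2 * (real N * (c_pu \<Omega> \<kappa> N \<rho>)\<^sup>2)"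
proof -
  let ?E = "energy \<Omega> \<kappa> e e" and ?v = "\<lambda>i x. \<rho> i x * e x"
  let ?n = "\<lambda>i. energy_norm \<Omega> \<kappa> (?v i)" and ?c = "(c_pu \<Omega> \<kappa> N \<rho>)\<^sup>2"
  have v: "?v i \<in> W i" "?v i \<in> H10 \<Omega>" if "i \<in> {1..N}" for i
    using local[OF that e] W[OF that] by auto
  have sum: "(\<lambda>x. \<Sum>i=1..N. ?v i x) \<in> H10 \<Omega>"
    "energy \<Omega> \<kappa> (\<lambda>x. \<Sum>i=1..N. ?v i x) e = (\<Sum>i=1..N. energy \<Omega> \<kappa> (?v i) e)"
    using energy_sum_left[of "{1..N}" ?v e] v(2) e by auto
  have "AE x in lebesgue_on \<Omega>. (\<Sum>i=1..N. ?v i x) = e x"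
    using \<rho>_sum by eventually_elim (simp add: sum_distrib_right[symmetric])
  from energy_AE[OF sum(1) e this] have "?E = (\<Sum>i=1..N. energy \<Omega> \<kappa> (?v i) e)"
    using sum(2) by simp
  also have "\<dots> = (\<Sum>i=1..N. R (?v i))"
    using v(2) by (intro sum.cong) (auto simp: R energy_commute)
  also have "\<dots> \<le> (\<Sum>i=1..N. D * ?n i)"
  proof (rule sum_mono)
    fix i assume i: "i \<in> {1..N}"
    have "R (?v i) \<le> dual_norm \<Omega> \<kappa> (W i) R * ?n i"
      by (rule le_dual_norm_mult[OF W[OF i] e _ v(1)[OF i]]) (use W[OF i] R in blast)
    also have "\<dots> \<le> D * ?n i"
      by (intro mult_right_mono max i energy_norm_nonneg v(2))
    finally show "R (?v i) \<le> D * ?n i" .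
  qed
  finally have E: "?E \<le> D * (\<Sum>i=1..N. ?n i)" by (simp add: sum_distrib_left)
  have S: "0 \<le> (\<Sum>i=1..N. ?n i)"
    by (intro sum_nonneg energy_norm_nonneg v(2))
  show "D > 0"
    using E S pos by (meson less_le_trans linorder_not_less mult_nonpos_nonneg)
  have "?E * ?E \<le> (D * (\<Sum>i=1..N. ?n i))\<^sup>2"
    using E pos unfolding power2_eq_square by (intro mult_mono) auto
  also have "\<dots> \<le> D\<^sup>2 * (real N * (\<Sum>i=1..N. (?n i)\<^sup>2))"
    using Cauchy_Schwarz_ineq_sum[of ?n "\<lambda>_. 1" "{1..N}"]
    by (simp add: power_mult_distrib mult_left_mono mult.commute)
  also have "\<dots> \<le> D\<^sup>2 * (real N * (?c * (energy_norm \<Omega> \<kappa> e)\<^sup>2))"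
    using pos by (intro mult_left_mono c_pu_bound \<rho> v(2) e) (use W local in \<open>auto simp: energy_norm_def\<close>)
  also have "\<dots> = D\<^sup>2 * (real N * ?c) * ?E"
    using energy_norm_square[OF e] by (simp add: mult.assoc)
  finally show "?E \<le> D\<^sup>2 * (real N * ?c)"
    using pos by simp
qed

end

section \<open>Convergence of the enrichment algorithm\<close>

lemma reduced_space_subset_H10:
  assumes \<Omega>: "open \<Omega>"
    and subdomains: "\<And>i. i \<in> {1..N} \<Longrightarrow> open (\<omega> i) \<and> \<omega> i \<noteq> {} \<and> \<omega> i \<subseteq> \<Omega>"
    and algorithm: "online_enrichment \<Omega> \<kappa> f N \<omega> Vr ur"
  shows "Vr n \<subseteq> H10 \<Omega>"
proof (induction n)
  case 0
  show ?case
  proof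
    fix v assume "v \<in> Vr 0"
    then have "AE x in lebesgue_on \<Omega>. v x = 0"
      using algorithm by (simp add: online_enrichment_def ae_eq_def)
    then have "AE x in lebesgue_on \<Omega>. 0 = v x"
      by eventually_elim simp
    then show "v \<in> H10 \<Omega>" by (rule H10_AE[OF \<Omega> H10_zero[OF \<Omega>]])
  qed
next
  case (Suc n)
  have "\<exists>k\<in>{1..N}. \<exists>uh. uh \<in> H10_ext \<Omega> (\<omega> k) \<and> Vr (Suc n) = add_span \<Omega> (Vr n) uh"
    using algorithm unfolding online_enrichment_def galerkin_solution_def by blast
  then obtain k uh where k: "k \<in> {1..N}" "uh \<in> H10_ext \<Omega> (\<omega> k)" "Vr (Suc n) = add_span \<Omega> (Vr n) uh"
    by blast
  have uh: "uh \<in> H10 \<Omega>"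
    using H10_ext_subset_H10[OF _ \<Omega>] subdomains k(1,2) by blast
  show ?case
  proof
    fix z assume "z \<in> Vr (Suc n)"
    then obtain w c where w: "w \<in> Vr n" and z: "AE x in lebesgue_on \<Omega>. z x = w x + c * uh x"
      by (auto simp: k(3) add_span_def ae_eq_def)
    have "(\<lambda>x. w x + c * uh x) \<in> H10 \<Omega>"
      using w Suc.IH uh by (intro H10_add H10_scale \<Omega>) auto
    moreover have "AE x in lebesgue_on \<Omega>. w x + c * uh x = z x"
      using z by eventually_elim simp
    ultimately show "z \<in> H10 \<Omega>" by (rule H10_AE[OF \<Omega>])
  qed
qed

theorem theorem1:
  fixes \<Omega> :: "'a::euclidean_space set"
    and \<kappa> f u :: "'a \<Rightarrow> real"
    and \<kappa>min \<kappa>max :: real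
    and N :: nat
    and \<omega> :: "nat \<Rightarrow> 'a set"
    and \<rho> :: "nat \<Rightarrow> 'a \<Rightarrow> real"
    and Vr :: "nat \<Rightarrow> ('a \<Rightarrow> real) set"
    and ur :: "nat \<Rightarrow> 'a \<Rightarrow> real"
    and n :: nat
  assumes dim: "DIM('a) \<in> {2, 3}"
    and domain: "open \<Omega>" "connected \<Omega>" "\<Omega> \<noteq> {}" "bounded \<Omega>"
    and \<kappa>_meas: "\<kappa> \<in> borel_measurable (lebesgue_on \<Omega>)"
    and \<kappa>_bounds: "0 < \<kappa>min" "AE x in lebesgue_on \<Omega>. \<kappa>min \<le> \<kappa> x \<and> \<kappa> x \<le> \<kappa>max"
    and f: "f \<in> L2 \<Omega>"
    and u: "galerkin_solution \<Omega> \<kappa> (H10 \<Omega>) (load \<Omega> f) u"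
    and subdomains: "\<And>i. i \<in> {1..N} \<Longrightarrow> open (\<omega> i) \<and> \<omega> i \<noteq> {} \<and> \<omega> i \<subseteq> \<Omega>"
    and cover: "(\<Union>i\<in>{1..N}. \<omega> i) = \<Omega>"
    and \<rho>_reg: "\<And>i. i \<in> {1..N} \<Longrightarrow> \<rho> i \<in> W1inf \<Omega>"
    and \<rho>_sum: "AE x in lebesgue_on \<Omega>. (\<Sum>i=1..N. \<rho> i x) = 1"
    and \<rho>_local: "\<And>i \<phi>. i \<in> {1..N} \<Longrightarrow> \<phi> \<in> H10 \<Omega> \<Longrightarrow> (\<lambda>x. \<rho> i x * \<phi> x) \<in> H10_ext \<Omega> (\<omega> i)"
    and algorithm: "online_enrichment \<Omega> \<kappa> f N \<omega> Vr ur"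
  shows "energy_norm \<Omega> \<kappa> (\<lambda>x. u x - ur (Suc n) x)
           \<le> sqrt (1 - (1 / real N) * (1 / (c_pu \<Omega> \<kappa> N \<rho>)\<^sup>2)) * energy_norm \<Omega> \<kappa> (\<lambda>x. u x - ur n x)"
proof -
  interpret diffusion \<Omega> \<kappa> \<kappa>min \<kappa>max
    by unfold_locales (use domain \<kappa>_meas \<kappa>_bounds in auto)
  define R where "R = residual \<Omega> \<kappa> f (ur n)"
  define W where "W = (\<lambda>i. H10_ext \<Omega> (\<omega> i))"
  define e where "e = (\<lambda>x. u x - ur n x)"
  define e' where "e' = (\<lambda>x. u x - ur (Suc n) x)"
  note Vr = reduced_space_subset_H10[OF domain(1) subdomains algorithm]
  have galerkin: "ur m \<in> Vr m" "\<And>\<phi>. \<phi> \<in> Vr m \<Longrightarrow> energy \<Omega> \<kappa> (ur m) \<phi> = load \<Omega> f \<phi>" for m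
    using algorithm by (auto simp: online_enrichment_def galerkin_solution_def)
  have uH: "u \<in> H10 \<Omega>" and u_eq: "\<And>\<phi>. \<phi> \<in> H10 \<Omega> \<Longrightarrow> energy \<Omega> \<kappa> u \<phi> = load \<Omega> f \<phi>"
    using u by (auto simp: galerkin_solution_def)
  have urH: "ur m \<in> H10 \<Omega>" for m
    using galerkin(1) Vr by blast
  have eH: "e \<in> H10 \<Omega>" and e'H: "e' \<in> H10 \<Omega>"
    unfolding e_def e'_def by (intro H10_diff domain(1) uH urH)+
  have W: "W i \<subseteq> H10 \<Omega>" if "i \<in> {1..N}" for i
    unfolding W_def using H10_ext_subset_H10[OF _ domain(1)] subdomains[OF that] by blast
  have R: "R \<phi> = energy \<Omega> \<kappa> e \<phi>" if "\<phi> \<in> H10 \<Omega>" for \<phi>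
    using that energy_diff_left[OF uH urH that] by (simp add: R_def residual_def e_def u_eq)
  have "\<exists>k\<in>{1..N}. \<exists>uh. (\<forall>i\<in>{1..N}. dual_norm \<Omega> \<kappa> (W i) R \<le> dual_norm \<Omega> \<kappa> (W k) R)
      \<and> galerkin_solution \<Omega> \<kappa> (W k) R uh \<and> Vr (Suc n) = add_span \<Omega> (Vr n) uh"
    using algorithm unfolding online_enrichment_def R_def W_def by blast
  then obtain k uh where k: "k \<in> {1..N}"
    and max: "\<And>i. i \<in> {1..N} \<Longrightarrow> dual_norm \<Omega> \<kappa> (W i) R \<le> dual_norm \<Omega> \<kappa> (W k) R"
    and uhW: "uh \<in> W k" and uh: "\<And>\<phi>. \<phi> \<in> W k \<Longrightarrow> energy \<Omega> \<kappa> uh \<phi> = R \<phi>"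
    and Suc: "Vr (Suc n) = add_span \<Omega> (Vr n) uh"
    by (auto simp: galerkin_solution_def)
  have uhH: "uh \<in> H10 \<Omega>" using uhW W[OF k] by blast
  define D where "D = dual_norm \<Omega> \<kappa> (W k) R"
  have "nonzero_elements \<Omega> (W k) \<noteq> {}"
    unfolding W_def using subdomains[OF k] by (intro H10_ext_nonzero_elements domain(1)) auto
  then have D: "D \<le> energy_norm \<Omega> \<kappa> uh"
    unfolding D_def by (intro dual_norm_le_representer W k uhH) (simp_all add: uh)

  \<comment> \<open>best approximation by the enlarged space, compared with the competitor \<open>u\<^sub>n + r\<close>\<close>
  have best: "energy \<Omega> \<kappa> e' e' \<le> energy \<Omega> \<kappa> e e - energy \<Omega> \<kappa> uh uh"
  proof -
    define p where "p = (\<lambda>x. ur n x + uh x)"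
    define d where "d = (\<lambda>x. p x - ur (Suc n) x)"
    have pH: "p \<in> H10 \<Omega>" unfolding p_def by (intro H10_add domain(1) urH uhH)
    have dH: "d \<in> H10 \<Omega>" unfolding d_def by (intro H10_diff domain(1) pH urH)
    have "p \<in> Vr (Suc n)"
      unfolding Suc add_span_def p_def using galerkin(1)[of n]
      by (auto simp: ae_eq_def intro!: bexI[of _ "ur n"] exI[of _ "1::real"])
    moreover have orth: "energy \<Omega> \<kappa> e' \<phi> = 0" if "\<phi> \<in> Vr (Suc n)" for \<phi>
    proof -
      have "\<phi> \<in> H10 \<Omega>" using that Vr by blast
      then show ?thesis
        unfolding e'_def using energy_diff_left[OF uH urH] u_eq galerkin(2)[OF that] by simp
    qed
    ultimately have "energy \<Omega> \<kappa> p e' - energy \<Omega> \<kappa> (ur (Suc n)) e' = 0"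
      using galerkin(1)[of "Suc n"] by (simp add: energy_commute[of _ e'])
    then have "energy \<Omega> \<kappa> e' d = 0"
      unfolding d_def using energy_diff_left[OF pH urH e'H] by (simp add: energy_commute[of e'])
    then have "energy \<Omega> \<kappa> (\<lambda>x. e' x - d x) (\<lambda>x. e' x - d x) = energy \<Omega> \<kappa> e' e' + energy \<Omega> \<kappa> d d"
      using energy_diff_square[OF e'H dH] by simp
    moreover have "(\<lambda>x. e' x - d x) = (\<lambda>x. e x - uh x)"
      by (simp add: e_def e'_def d_def p_def fun_eq_iff)
    moreover have "energy \<Omega> \<kappa> (\<lambda>x. e x - uh x) (\<lambda>x. e x - uh x) = energy \<Omega> \<kappa> e e - energy \<Omega> \<kappa> uh uh"
      using energy_diff_square[OF eH uhH] R[OF uhH] uh[OF uhW] by simp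
    ultimately show ?thesis
      using energy_nonneg[OF dH] by simp
  qed

  have "energy_norm \<Omega> \<kappa> e' \<le> sqrt (1 - (1 / real N) * (1 / (c_pu \<Omega> \<kappa> N \<rho>)\<^sup>2)) * energy_norm \<Omega> \<kappa> e"
  proof (cases "energy \<Omega> \<kappa> e e = 0")
    \<comment> \<open>both sides vanish, whatever the value of the contraction factor\<close>
    case True
    then have "energy \<Omega> \<kappa> e' e' = 0"
      using best energy_nonneg[OF uhH] energy_nonneg[OF e'H] by simp
    then show ?thesis using True by (simp add: energy_norm_def)
  next
    case False
    then have pos: "energy \<Omega> \<kappa> e e > 0" using energy_nonneg[OF eH] by simp
    let ?A = "real N * (c_pu \<Omega> \<kappa> N \<rho>)\<^sup>2"
    have local: "(\<lambda>x. \<rho> i x * \<phi> x) \<in> W i" if "i \<in> {1..N}" "\<phi> \<in> H10 \<Omega>" for i \<phi>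
      unfolding W_def by (rule \<rho>_local[OF that])
    note E = energy_le_maximal_dual_norm[OF \<rho>_reg \<rho>_sum W local eH R max[folded D_def] pos]
    have A: "?A > 0"
    proof (rule ccontr)
      assume "\<not> ?A > 0"
      then have "D\<^sup>2 * ?A \<le> 0"
        by (intro mult_nonneg_nonpos[OF zero_le_power2]) (simp only: not_less)
      with E(2) pos show False by linarith
    qed
    have "energy \<Omega> \<kappa> e e * (1 / ?A) \<le> D\<^sup>2"
      using E(2) A by (simp add: divide_le_eq)
    also have "D\<^sup>2 \<le> energy \<Omega> \<kappa> uh uh"
      unfolding energy_norm_square[OF uhH, symmetric] using D E(1) by (intro power_mono) auto
    finally have "energy \<Omega> \<kappa> e' e' \<le> (1 - 1 / ?A) * energy \<Omega> \<kappa> e e"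
      using best by (simp add: algebra_simps)
    then have "sqrt (energy \<Omega> \<kappa> e' e') \<le> sqrt ((1 - 1 / ?A) * energy \<Omega> \<kappa> e e)"
      by (rule real_sqrt_le_mono)
    then show ?thesis
      by (simp add: energy_norm_def real_sqrt_mult)
  qed
  then show ?thesis by (simp only: e_def e'_def)
qed

end
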